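(* Let $\zeta>0$ be a slip length (a positive scalar function on $\Gamma$) and let $u\in C^1(\overline\Omega)$ be a vector field. Then $u$ satisfies the Navier boundary condition $$u^{k}=-\zeta\left(\nabla_{3}u^{k}+\nabla_{k}u^{3}\right)\quad\text{on }\Gamma,\qquad k=1,2,$$ (in moving frames compatible to $\Gamma$) if and only if $$\left(\nabla\times u\right)^{\Vert}\Big|_{\Gamma}=-\frac{1}{\zeta}(\ast u^{\Vert})-2\big(\ast\nabla^{\Gamma}\langle u,\nu\rangle\big)+2\big(\ast\pi(u^{\Vert})\big).$$ In terms of components in a moving frame compatible to the boundary, the latter condition reads $$(\nabla\times u)^{1}=\frac{1}{\zeta}u^{2}+2\nabla_{2}\langle u,\nu\rangle-2\sum_{j=1,2}\pi_{j2}u^{j},\qquad (\nabla\times u)^{2}=-\frac{1}{\zeta}u^{1}-2\nabla_{1}\langle u,\nu\rangle+2\sum_{j=1,2}\pi_{j1}u^{j}.$$ In particular, if $u$ satisfies the kinematic condition $u^{\bot}|_{\Gamma}=0$, then the Navier boundary condition is equivalent to $$(\nabla\times u)^{\Vert}\big|_{\Gamma}=-\frac{1}{\zeta}(\ast u)+2\big(\ast\pi(u)\big).$$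
   Context: $\Omega\subset\mathbb{R}^3$ is a bounded domain whose boundary $\Gamma=\partial\Omega$ is smooth, compact and oriented; $\nu$ is the outward unit normal. A moving frame compatible to $\Gamma$ is a local (right-handed) orthonormal frame $(e_1,e_2,e_3)$ of the tangent space of $\Omega$ with $e_3=\nu$ on $\Gamma$. Write $u=\sum_j u^je_j$. On $\Gamma$, $u^{\Vert}=u^1e_1+u^2e_2$ is the tangential part and $u^{\bot}=u^3\nu=\langle u,\nu\rangle\nu$ the normal part. $\nabla_iu^k$ denotes the $k$-th frame component of the (Euclidean) covariant derivative of the vector field $u$ in the direction $e_i$; in particular, for $i=1,2$, $\nabla_iu^3=e_i(u^3)+\sum_{j=1,2}\Gamma_{ij}^3u^j$ on $\Gamma$, where $\nabla_{e_i}e_j=\sum_k\Gamma_{ij}^ke_k$. For the scalar $\langle u,\nu\rangle$, $\nabla_i\langle u,\nu\rangle=e_i(\langle u,\nu\rangle)$, $i=1,2$, and $\nabla^{\Gamma}\langle u,\nu\rangle$ is its gradient on the surface $\Gamma$. The second fundamental form is $\pi_{ij}=-\Gamma_{ij}^3$, $i,j=1,2$, i.e. $\pi(a,b)=\langle\nabla_a\nu,b\rangle$ for $a,b$ tangent to $\Gamma$; it is identified with the self-adjoint operator $\pi(\cdot)$ on tangent vectors given by $\langle\pi(a),b\rangle=\pi(a,b)$. The Hodge star acts on tangent vectors by $\ast(v^1,v^2)=(-v^2,v^1)$, i.e. $\ast v=\nu\times v$. *)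

theory Defs
  imports "HOL-Analysis.Analysis"
begin

section \<open>Smooth maps and bounded domains with smooth boundary\<close>

text \<open>Continuous differentiability of order k on an open set, by iterated directional
  derivatives along the standard basis.\<close>

primrec Ck_on :: "nat \<Rightarrow> ('a::euclidean_space \<Rightarrow> 'b::real_normed_vector) \<Rightarrow> 'a set \<Rightarrow> bool" where
  "Ck_on 0 f U \<longleftrightarrow> continuous_on U f"
| "Ck_on (Suc k) f U \<longleftrightarrow> f differentiable_on U \<and>
     (\<forall>b\<in>Basis. Ck_on k (\<lambda>x. frechet_derivative f (at x) b) U)"

definition smooth_map_on :: "('a::euclidean_space \<Rightarrow> 'b::real_normed_vector) \<Rightarrow> 'a set \<Rightarrow> bool" where
  "smooth_map_on f U \<longleftrightarrow> open U \<and> (\<forall>k. Ck_on k f U)"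

definition local_defining_function :: "(real^3) set \<Rightarrow> (real^3) set \<Rightarrow> (real^3 \<Rightarrow> real) \<Rightarrow> bool" where
  "local_defining_function \<Omega> U \<phi> \<longleftrightarrow>
     smooth_map_on \<phi> U \<and>
     (\<forall>x\<in>U. \<exists>g. GDERIV \<phi> x :> g \<and> g \<noteq> 0) \<and>
     \<Omega> \<inter> U = {x \<in> U. \<phi> x < 0} \<and>
     frontier \<Omega> \<inter> U = {x \<in> U. \<phi> x = 0}"

definition bounded_smooth_domain :: "(real^3) set \<Rightarrow> bool" where
  "bounded_smooth_domain \<Omega> \<longleftrightarrow>
     open \<Omega> \<and> connected \<Omega> \<and> \<Omega> \<noteq> {} \<and> bounded \<Omega> \<and>
     (\<forall>p\<in>frontier \<Omega>. \<exists>U \<phi>. p \<in> U \<and> local_defining_function \<Omega> U \<phi>)"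

text \<open>The normalised gradient of a function that is negative exactly inside the domain
  points outward and does not depend on the choice of the function.\<close>

definition outward_normal :: "(real^3) set \<Rightarrow> real^3 \<Rightarrow> real^3" where
  "outward_normal \<Omega> x = (THE n. \<exists>U \<phi> g. x \<in> U \<and> local_defining_function \<Omega> U \<phi> \<and>
     GDERIV \<phi> x :> g \<and> n = g /\<^sub>R norm g)"


section \<open>Vector fields that are continuously differentiable up to the boundary\<close>

definition C1_on_closure :: "(real^3) set \<Rightarrow> (real^3 \<Rightarrow> real^3) \<Rightarrow> bool" where
  "C1_on_closure \<Omega> u \<longleftrightarrow>
     continuous_on (closure \<Omega>) u \<and> u differentiable_on \<Omega> \<and>
     (\<exists>J. continuous_on (closure \<Omega>) J \<and> (\<forall>x\<in>\<Omega>. J x = jacobian u (at x)))"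

text \<open>The continuous extension of the Jacobian matrix from the open set to its closure;
  at points of the open set it is the ordinary Jacobian. This is the derivative of the field
  that enters boundary conditions: values of \<open>u\<close> outside the closure are irrelevant.\<close>

definition ext_jacobian :: "(real^3) set \<Rightarrow> (real^3 \<Rightarrow> real^3) \<Rightarrow> real^3 \<Rightarrow> real^3^3" where
  "ext_jacobian \<Omega> u x = Lim (at x within \<Omega>) (\<lambda>y. jacobian u (at y))"

definition curl :: "(real^3) set \<Rightarrow> (real^3 \<Rightarrow> real^3) \<Rightarrow> real^3 \<Rightarrow> real^3" where
  "curl \<Omega> u x = (let J = ext_jacobian \<Omega> u x in
     vector [J $ 3 $ 2 - J $ 2 $ 3, J $ 1 $ 3 - J $ 3 $ 1, J $ 2 $ 1 - J $ 1 $ 2])"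


section \<open>Geometry of the boundary surface\<close>

definition tangent_plane :: "(real^3) set \<Rightarrow> real^3 \<Rightarrow> (real^3) set" where
  "tangent_plane \<Omega> x = {a. a \<bullet> outward_normal \<Omega> x = 0}"

definition normal_part :: "(real^3) set \<Rightarrow> real^3 \<Rightarrow> real^3 \<Rightarrow> real^3" where
  "normal_part \<Omega> x v = (v \<bullet> outward_normal \<Omega> x) *\<^sub>R outward_normal \<Omega> x"

definition tangential_part :: "(real^3) set \<Rightarrow> real^3 \<Rightarrow> real^3 \<Rightarrow> real^3" where
  "tangential_part \<Omega> x v = v - normal_part \<Omega> x v"

definition hodge_star :: "(real^3) set \<Rightarrow> real^3 \<Rightarrow> real^3 \<Rightarrow> real^3" where
  "hodge_star \<Omega> x v = cross3 (outward_normal \<Omega> x) v"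

text \<open>Derivative at \<open>x\<close> of a map given on the boundary surface, in a direction \<open>a\<close> of the tangent
  plane. A Frechet derivative within the surface is not unique as a linear map on the
  ambient space, but its values on the tangent plane are; it is only used there.\<close>

definition surface_deriv ::
    "(real^3) set \<Rightarrow> (real^3 \<Rightarrow> 'b::real_normed_vector) \<Rightarrow> real^3 \<Rightarrow> real^3 \<Rightarrow> 'b" where
  "surface_deriv \<Omega> f x a = frechet_derivative f (at x within frontier \<Omega>) a"

definition surface_grad :: "(real^3) set \<Rightarrow> (real^3 \<Rightarrow> real) \<Rightarrow> real^3 \<Rightarrow> real^3" where
  "surface_grad \<Omega> f x = (THE g. g \<in> tangent_plane \<Omega> x \<and>
     (\<forall>a\<in>tangent_plane \<Omega> x. g \<bullet> a = surface_deriv \<Omega> f x a))"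

definition second_fundamental_form :: "(real^3) set \<Rightarrow> real^3 \<Rightarrow> real^3 \<Rightarrow> real^3 \<Rightarrow> real" where
  "second_fundamental_form \<Omega> x a b = surface_deriv \<Omega> (outward_normal \<Omega>) x a \<bullet> b"

definition shape_operator :: "(real^3) set \<Rightarrow> real^3 \<Rightarrow> real^3 \<Rightarrow> real^3" where
  "shape_operator \<Omega> x a = (THE w. w \<in> tangent_plane \<Omega> x \<and>
     (\<forall>b\<in>tangent_plane \<Omega> x. w \<bullet> b = second_fundamental_form \<Omega> x a b))"

definition normal_component :: "(real^3) set \<Rightarrow> (real^3 \<Rightarrow> real^3) \<Rightarrow> real^3 \<Rightarrow> real" where
  "normal_component \<Omega> u x = u x \<bullet> outward_normal \<Omega> x"


section \<open>Moving frames and the Navier boundary condition\<close>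

text \<open>A moving frame lives on the relatively open subset \<open>W \<inter> closure \<Omega>\<close> of the closed domain;
  smoothness up to the boundary means that the frame fields are restrictions of smooth fields
  on the open set \<open>W\<close>.\<close>

definition compatible_frame :: "(real^3) set \<Rightarrow> (real^3) set \<Rightarrow> (3 \<Rightarrow> real^3 \<Rightarrow> real^3) \<Rightarrow> bool" where
  "compatible_frame \<Omega> W e \<longleftrightarrow>
     (\<forall>i. smooth_map_on (e i) W) \<and>
     (\<forall>x \<in> W \<inter> closure \<Omega>.
        (\<forall>i j. e i x \<bullet> e j x = (if i = j then 1 else 0)) \<and>
        cross3 (e 1 x) (e 2 x) = e 3 x) \<and>
     (\<forall>x \<in> W \<inter> frontier \<Omega>. e 3 x = outward_normal \<Omega> x)"

definition frame_comp :: "(3 \<Rightarrow> real^3 \<Rightarrow> real^3) \<Rightarrow> real^3 \<Rightarrow> real^3 \<Rightarrow> 3 \<Rightarrow> real" where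
  "frame_comp e x v k = v \<bullet> e k x"

text \<open>\<open>frame_nabla \<Omega> e u x i k\<close> is the \<open>k\<close>-th frame component of the Euclidean covariant derivative
  of \<open>u\<close> in the direction \<open>e\<^sub>i\<close>.\<close>

definition frame_nabla ::
    "(real^3) set \<Rightarrow> (3 \<Rightarrow> real^3 \<Rightarrow> real^3) \<Rightarrow> (real^3 \<Rightarrow> real^3) \<Rightarrow> real^3 \<Rightarrow> 3 \<Rightarrow> 3 \<Rightarrow> real" where
  "frame_nabla \<Omega> e u x i k = frame_comp e x (ext_jacobian \<Omega> u x *v e i x) k"

definition navier_bc :: "(real^3) set \<Rightarrow> (real^3 \<Rightarrow> real) \<Rightarrow> (real^3 \<Rightarrow> real^3) \<Rightarrow> bool" where
  "navier_bc \<Omega> \<zeta> u \<longleftrightarrow>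
     (\<forall>W e. compatible_frame \<Omega> W e \<longrightarrow>
       (\<forall>x \<in> W \<inter> frontier \<Omega>. \<forall>k\<in>{1, 2}.
          frame_comp e x (u x) k
            = - \<zeta> x * (frame_nabla \<Omega> e u x 3 k + frame_nabla \<Omega> e u x k 3)))"

end

theory Submission
  imports Defs
begin

text \<open>The equivalence holds point by point on the boundary. Fix a boundary point, a compatible
  frame \<open>e\<^sub>1, e\<^sub>2, \<nu>\<close> there, and let \<open>J\<close> be the Jacobian of \<open>u\<close>. The curl collects
  the antisymmetric part of \<open>J\<close>: \<open>(\<nabla> \<times> u)\<^sup>1 = \<langle>J e\<^sub>2, \<nu>\<rangle> - \<langle>J \<nu>, e\<^sub>2\<rangle>\<close>. The Navier condition
  prescribes the symmetric part \<open>\<langle>J e\<^sub>2, \<nu>\<rangle> + \<langle>J \<nu>, e\<^sub>2\<rangle>\<close> as \<open>- u\<^sup>2 / \<zeta>\<close>. Their sum is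
  \<open>2 \<langle>J e\<^sub>2, \<nu>\<rangle>\<close>, which only involves a tangential derivative and the normal component: by the
  product rule it is \<open>2 \<nabla>\<^sub>2\<langle>u, \<nu>\<rangle> - 2 \<pi>(e\<^sub>2, u\<^sup>\<parallel>)\<close>. The second component is treated alike,
  and applying the Hodge star turns the components into the vector identity
  (lemmas \<open>vorticity_condition_iff_components\<close> and
  \<open>navier_at_point_iff_vorticity_condition\<close>).

  Most of the work is to justify this computation at the boundary.

  First, \<open>u\<close> must be differentiable at boundary points within the closed domain, with the extended
  Jacobian as its derivative; this follows from the continuity of the Jacobian because boundary
  points can be joined to their neighbours by two segments inside the domain, of comparable length
  (\<open>C1_on_closure_has_derivative\<close>).

  Second, the derivative within the boundary surface must have well-defined values on the
  tangent plane, which holds because every ray in the plane is approximated to first order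
  by points of the surface
  (\<open>tangent_vector_level_set\<close>, \<open>frechet_derivative_tangent_vector\<close>).

  Third, the second fundamental form must be symmetric. It is the Hessian of a defining function
  divided by the length of the gradient, so the symmetry is Schwarz's theorem
  (\<open>derivative_of_gradient_symmetric\<close>, \<open>chart_normal_derivative_symmetric\<close>).

  Finally, the Navier condition quantifies over frames and would say nothing at a
  point without one; \<open>compatible_frame_exists\<close> provides a frame near every boundary point. Its
  smoothness, and that of the unit normal, rest on closure properties of smooth maps under
  bilinear products and normalisation.\<close>


section \<open>Calculus of k times continuously differentiable maps\<close>

lemma Ck_on_differentiable_at:
  assumes "open U" "Ck_on (Suc k) f U" "x \<in> U"
  shows "f differentiable (at x)"
  using assms by (simp add: differentiable_on_eq_differentiable_at)

lemma Ck_on_has_derivative: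
  assumes "open U" "Ck_on (Suc k) f U" "x \<in> U"
  shows "(f has_derivative frechet_derivative f (at x)) (at x)"
  using Ck_on_differentiable_at[OF assms] by (simp add: frechet_derivative_works)

lemma Ck_on_SucI:
  assumes "open U"
    and der: "\<And>x. x \<in> U \<Longrightarrow> (f has_derivative f' x) (at x)"
    and Ck: "\<And>b. b \<in> Basis \<Longrightarrow> Ck_on k (\<lambda>x. frechet_derivative f (at x) b) U"
  shows "Ck_on (Suc k) f U"
  using assms by (auto simp: differentiable_on_eq_differentiable_at intro: differentiableI)

lemma Ck_on_cong:
  assumes "open U" "Ck_on k f U" "\<And>x. x \<in> U \<Longrightarrow> f x = g x"
  shows "Ck_on k g U"
  using assms(2,3)
proof (induction k arbitrary: f g)
  case 0
  then show ?case by (simp cong: continuous_on_cong)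
next
  case (Suc k)
  have der: "(g has_derivative frechet_derivative f (at x)) (at x)" if "x \<in> U" for x
    using has_derivative_transform_within_open[OF Ck_on_has_derivative[OF assms(1) Suc.prems(1) that]
        assms(1) that] Suc.prems(2) by blast
  show ?case
  proof (rule Ck_on_SucI[OF assms(1) der])
    fix b :: 'a assume b: "b \<in> Basis"
    show "Ck_on k (\<lambda>x. frechet_derivative g (at x) b) U"
      by (rule Suc.IH[of "\<lambda>x. frechet_derivative f (at x) b"])
        (use Suc.prems b frechet_derivative_at[OF der] in auto)
  qed
qed

text \<open>The induction step of the closure properties below: regularity may be checked on any explicit
  formula for the derivative.\<close>

lemma Ck_on_SucI_explicit:
  assumes "open U"
    and der: "\<And>x. x \<in> U \<Longrightarrow> (f has_derivative f' x) (at x)"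
    and Ck: "\<And>b. b \<in> Basis \<Longrightarrow> Ck_on k (\<lambda>x. f' x b) U"
  shows "Ck_on (Suc k) f U"
proof (rule Ck_on_SucI[OF assms(1) der])
  fix b :: 'a assume "b \<in> Basis"
  then show "Ck_on k (\<lambda>x. frechet_derivative f (at x) b) U"
    by (intro Ck_on_cong[OF assms(1) Ck]) (simp_all add: frechet_derivative_at[OF der, symmetric])
qed

lemma Ck_on_Suc_imp:
  assumes "open U" "Ck_on (Suc k) f U"
  shows "Ck_on k f U"
  using assms(2)
proof (induction k arbitrary: f)
  case 0
  then show ?case by (simp add: differentiable_imp_continuous_on)
next
  case (Suc k)
  then show ?case by simp
qed

lemma Ck_on_subset: "Ck_on k f U \<Longrightarrow> V \<subseteq> U \<Longrightarrow> Ck_on k f V"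
  by (induction k arbitrary: f)
    (auto intro: continuous_on_subset differentiable_on_subset)

lemma Ck_on_const: "open U \<Longrightarrow> Ck_on k (\<lambda>x. c) U"
proof (induction k arbitrary: c)
  case (Suc k)
  then show ?case
    by (intro Ck_on_SucI_explicit[where f' = "\<lambda>x h. 0"]) auto
qed simp

lemma Ck_on_add:
  assumes "open U" "Ck_on k f U" "Ck_on k g U"
  shows "Ck_on k (\<lambda>x. f x + g x) U"
  using assms(2,3)
proof (induction k arbitrary: f g)
  case 0
  then show ?case by (simp add: continuous_on_add)
next
  case (Suc k)
  show ?case
    by (rule Ck_on_SucI_explicit[OF assms(1) has_derivative_add[OF
            Ck_on_has_derivative[OF assms(1) Suc.prems(1)] Ck_on_has_derivative[OF assms(1) Suc.prems(2)]]])
      (use Suc in auto)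
qed

lemma Ck_on_sum:
  assumes "open U" "\<And>i. i \<in> I \<Longrightarrow> Ck_on k (f i) U"
  shows "Ck_on k (\<lambda>x. \<Sum>i\<in>I. f i x) U"
  using assms(2)
proof (induction I rule: infinite_finite_induct)
  case (insert i I)
  then show ?case by (simp add: Ck_on_add[OF assms(1)])
qed (simp_all add: Ck_on_const[OF assms(1)])

lemma Ck_on_bilinear:
  assumes "bounded_bilinear m" "open U" "Ck_on k f U" "Ck_on k g U"
  shows "Ck_on k (\<lambda>x. m (f x) (g x)) U"
  using assms(3,4)
proof (induction k arbitrary: f g)
  case 0
  then show ?case by (simp add: bounded_bilinear.continuous_on[OF assms(1)])
next
  case (Suc k)
  note k = Suc.prems[THEN Ck_on_Suc_imp[OF assms(2)]]
  show ?case
    by (rule Ck_on_SucI_explicit[OF assms(2) bounded_bilinear.FDERIV[OF assms(1)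
            Ck_on_has_derivative[OF assms(2) Suc.prems(1)] Ck_on_has_derivative[OF assms(2) Suc.prems(2)]]])
      (use Suc k in \<open>auto intro!: Ck_on_add assms(2)\<close>)
qed

text \<open>The derivative of \<open>r = 1 / |g|\<close> in direction \<open>b\<close> is \<open>- r^3 \<langle>g, D\<^sub>b g\<rangle>\<close>, which
  involves only \<open>r\<close> itself and first derivatives of \<open>g\<close>, so the regularity of \<open>r\<close>
  follows by induction from that of products.\<close>

lemma Ck_on_inverse_norm:
  fixes g :: "'a::euclidean_space \<Rightarrow> 'b::real_inner"
  assumes "open U" "Ck_on k g U" and nz: "\<And>x. x \<in> U \<Longrightarrow> g x \<noteq> 0"
  shows "Ck_on k (\<lambda>x. inverse (norm (g x))) U"
  using assms(2)
proof (induction k)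
  case 0
  then show ?case using nz by (auto intro!: continuous_intros)
next
  case (Suc k)
  define r where "r x = inverse (norm (g x))" for x
  have der: "(r has_derivative
      (\<lambda>h. (- 1 * (r x * r x * r x)) * (g x \<bullet> frechet_derivative g (at x) h))) (at x)"
    if "x \<in> U" for x
  proof -
    have g: "(g has_derivative frechet_derivative g (at x)) (at x)"
      using Ck_on_has_derivative[OF assms(1) Suc.prems that] .
    have "((\<lambda>x. norm (g x)) has_derivative (\<lambda>h. frechet_derivative g (at x) h \<bullet> sgn (g x))) (at x)"
      using has_derivative_compose[OF g has_derivative_norm[OF nz[OF that]]] .
    from Deriv.has_derivative_inverse[OF _ this] nz[OF that] have
      "(r has_derivative (\<lambda>h. - (inverse (norm (g x)) *
        (frechet_derivative g (at x) h \<bullet> sgn (g x)) * inverse (norm (g x))))) (at x)"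
      unfolding r_def[abs_def] by simp
    then show ?thesis
      by (rule has_derivative_eq_rhs) (simp add: r_def sgn_div_norm inner_commute fun_eq_iff)
  qed
  have k: "Ck_on k r U" "Ck_on k g U"
    using Suc.IH Ck_on_Suc_imp[OF assms(1) Suc.prems] unfolding r_def[abs_def] by blast+
  have "Ck_on (Suc k) r U"
  proof (rule Ck_on_SucI_explicit[OF assms(1) der])
    fix b :: 'a assume "b \<in> Basis"
    then have "Ck_on k (\<lambda>x. frechet_derivative g (at x) b) U" using Suc.prems by simp
    then show "Ck_on k (\<lambda>x. (- 1 * (r x * r x * r x)) * (g x \<bullet> frechet_derivative g (at x) b)) U"
      by (intro Ck_on_bilinear[OF bounded_bilinear_mult assms(1)]
          Ck_on_bilinear[OF bounded_bilinear_inner assms(1)] Ck_on_const[OF assms(1)] k)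
  qed
  then show ?case by (simp add: r_def[abs_def])
qed

lemma bounded_bilinear_cross3: "bounded_bilinear cross3"
  using bilinear_cross bilinear_conv_bounded_bilinear by blast

lemma bounded_bilinear_matrix_vector_mult:
  "bounded_bilinear ((*v) :: real^'n^'m \<Rightarrow> real^'n \<Rightarrow> real^'m)"
  unfolding bilinear_conv_bounded_bilinear[symmetric] bilinear_def
  by (intro conjI allI linearI)
    (simp_all add: matrix_vector_right_distrib matrix_vector_mult_add_rdistrib
      matrix_vector_mult_scaleR scaleR_matrix_vector_assoc)

lemma smooth_map_on_unit:
  fixes g :: "real^3 \<Rightarrow> real^3"
  assumes "smooth_map_on g U" "\<And>x. x \<in> U \<Longrightarrow> g x \<noteq> 0"
  shows "smooth_map_on (\<lambda>x. g x /\<^sub>R norm (g x)) U"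
  using assms unfolding smooth_map_on_def
  by (intro conjI allI Ck_on_bilinear[OF bounded_bilinear_scaleR] Ck_on_inverse_norm) simp_all

lemma smooth_map_on_cross3:
  "smooth_map_on f U \<Longrightarrow> smooth_map_on g U \<Longrightarrow> smooth_map_on (\<lambda>x. cross3 (f x) (g x)) U"
  unfolding smooth_map_on_def by (intro conjI allI Ck_on_bilinear[OF bounded_bilinear_cross3]) simp_all

lemma smooth_map_on_const: "open U \<Longrightarrow> smooth_map_on (\<lambda>x. c) U"
  unfolding smooth_map_on_def by (auto intro: Ck_on_const)

lemma smooth_map_on_subset:
  "smooth_map_on f U \<Longrightarrow> V \<subseteq> U \<Longrightarrow> open V \<Longrightarrow> smooth_map_on f V"
  unfolding smooth_map_on_def by (auto intro: Ck_on_subset)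

lemma smooth_map_on_continuous: "smooth_map_on f U \<Longrightarrow> continuous_on U f"
  unfolding smooth_map_on_def by (metis Ck_on.simps(1))

lemma smooth_map_on_has_derivative:
  "smooth_map_on f U \<Longrightarrow> x \<in> U \<Longrightarrow> (f has_derivative frechet_derivative f (at x)) (at x)"
  unfolding smooth_map_on_def using Ck_on_has_derivative by blast


section \<open>Gradients and the symmetry of the Hessian\<close>

definition gradient :: "('a::euclidean_space \<Rightarrow> real) \<Rightarrow> 'a \<Rightarrow> 'a" where
  "gradient f x = (\<Sum>b\<in>Basis. frechet_derivative f (at x) b *\<^sub>R b)"

lemma linear_functional_eq_inner:
  fixes L :: "'a::euclidean_space \<Rightarrow> real"
  assumes "linear L"
  shows "L a = a \<bullet> (\<Sum>b\<in>Basis. L b *\<^sub>R b)"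
proof -
  have "L a = L (\<Sum>b\<in>Basis. (a \<bullet> b) *\<^sub>R b)" by (simp add: euclidean_representation)
  also have "\<dots> = (\<Sum>b\<in>Basis. (a \<bullet> b) * L b)"
    using assms by (simp add: linear_sum linear_scale)
  finally show ?thesis by (simp add: inner_sum_right mult.commute)
qed

lemma GDERIV_gradient:
  assumes "(f has_derivative frechet_derivative f (at x)) (at x)"
  shows "GDERIV f x :> gradient f x"
  unfolding gderiv_def gradient_def
  by (rule has_derivative_eq_rhs[OF assms ext])
    (rule linear_functional_eq_inner[OF has_derivative_linear[OF assms]])

lemma GDERIV_unique: "GDERIV f x :> g \<Longrightarrow> GDERIV f x :> h \<Longrightarrow> g = h"
  unfolding gderiv_def
  by (drule (1) has_derivative_unique) (metis vector_eq_ldot)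

lemma smooth_map_on_gradient:
  assumes "smooth_map_on f U"
  shows "smooth_map_on (gradient f) U"
proof -
  have "Ck_on k (\<lambda>x. frechet_derivative f (at x) b) U" if "b \<in> Basis" for k b
  proof -
    have "Ck_on (Suc k) f U" using assms unfolding smooth_map_on_def by blast
    then show ?thesis using that by simp
  qed
  then show ?thesis
    using assms unfolding smooth_map_on_def gradient_def
    by (intro conjI allI Ck_on_sum Ck_on_bilinear[OF bounded_bilinear_scaleR] Ck_on_const) simp_all
qed

lemma GDERIV_along_line:
  assumes "GDERIV f (x + t *\<^sub>R v) :> g"
  shows "((\<lambda>t. f (x + t *\<^sub>R v)) has_real_derivative (v \<bullet> g)) (at t)"
proof -
  have "((\<lambda>t. x + t *\<^sub>R v) has_derivative (\<lambda>t. t *\<^sub>R v)) (at t)"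
    by (auto intro!: derivative_eq_intros)
  from has_derivative_compose[OF this assms[unfolded gderiv_def]]
  show ?thesis unfolding has_field_derivative_def
    by (rule has_derivative_eq_rhs) (simp add: fun_eq_iff mult.commute)
qed

text \<open>One half of the classical proof of Schwarz's theorem: the mean value theorem, applied
  to the increment of \<open>f\<close> in direction \<open>b\<close> as it moves in direction \<open>a\<close>, shows that the
  second difference quotient of \<open>f\<close> tends to \<open>\<langle>a, H b\<rangle>\<close>. The second difference is symmetric
  in \<open>a\<close> and \<open>b\<close>, so its limit is symmetric too.\<close>

lemma second_difference_estimate:
  fixes f :: "'a::real_inner \<Rightarrow> real"
  assumes "open U" "x \<in> U" and grad: "\<And>y. y \<in> U \<Longrightarrow> GDERIV f y :> G y"
    and H: "(G has_derivative H) (at x)" and "e > 0"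
  shows "\<exists>d>0. \<forall>t. 0 < t \<and> t < d \<longrightarrow>
    \<bar>f (x + t *\<^sub>R a + t *\<^sub>R b) - f (x + t *\<^sub>R a) - f (x + t *\<^sub>R b) + f x - t\<^sup>2 * (a \<bullet> H b)\<bar>
      \<le> e * t\<^sup>2"
proof -
  interpret H: bounded_linear H using has_derivative_bounded_linear[OF H] .
  define C where "C = norm a + norm b + 1"
  have C: "C > 0" "norm a \<le> C" "norm b \<le> C" "norm a + norm b \<le> C" unfolding C_def by (auto intro: add_nonneg_pos)
  \<comment> \<open>Two errors, each at most \<open>e' t C\<close>, are paired with \<open>a\<close>, of length at most \<open>C\<close>.\<close>
  define e' where "e' = e / (2 * C * C)"
  have e': "e' > 0" using \<open>e > 0\<close> C by (simp add: e'_def)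
  obtain d1 where d1: "d1 > 0" "ball x d1 \<subseteq> U" using assms(1,2) open_contains_ball by blast
  obtain d2 where d2: "d2 > 0"
    and G: "\<And>y. norm (y - x) < d2 \<Longrightarrow> norm (G y - G x - H (y - x)) \<le> e' * norm (y - x)"
    using H e' unfolding has_derivative_at_alt by metis
  define d where "d = min d1 d2 / C"
  have "d > 0" using d1 d2 C by (simp add: d_def)
  moreover have "\<bar>f (x + t *\<^sub>R a + t *\<^sub>R b) - f (x + t *\<^sub>R a) - f (x + t *\<^sub>R b) + f x - t\<^sup>2 * (a \<bullet> H b)\<bar>
      \<le> e * t\<^sup>2" if t: "0 < t" "t < d" for t
  proof -
    have tC: "t * C < min d1 d2" using t C by (simp add: d_def field_simps)
    have small: "norm (s *\<^sub>R a + t *\<^sub>R b) \<le> t * C" "norm (s *\<^sub>R a) \<le> t * C" if "0 \<le> s" "s \<le> t" for s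
    proof -
      have "norm (s *\<^sub>R a + t *\<^sub>R b) \<le> s * norm a + t * norm b"
        using norm_triangle_ineq[of "s *\<^sub>R a" "t *\<^sub>R b"] that t by simp
      also have "\<dots> \<le> t * norm a + t * norm b" using that by (simp add: mult_right_mono)
      also have "\<dots> \<le> t * C" using C t by (metis distrib_left mult_left_mono less_imp_le)
      finally show "norm (s *\<^sub>R a + t *\<^sub>R b) \<le> t * C" .
      show "norm (s *\<^sub>R a) \<le> t * C" using that C t by (simp add: mult_mono)
    qed
    define psi where "psi s = f ((x + t *\<^sub>R b) + s *\<^sub>R a) - f (x + s *\<^sub>R a)" for s
    define psi' where "psi' s = a \<bullet> G ((x + t *\<^sub>R b) + s *\<^sub>R a) - a \<bullet> G (x + s *\<^sub>R a)" for s
    have "(psi has_real_derivative psi' s) (at s)" if "0 \<le> s" "s \<le> t" for s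
    proof -
      have "x + t *\<^sub>R b + s *\<^sub>R a \<in> U" "x + s *\<^sub>R a \<in> U"
        using small[OF that] tC d1(2) by (auto simp: subset_iff dist_norm norm_minus_commute algebra_simps)
      then show ?thesis unfolding psi_def psi'_def
        by (intro DERIV_diff GDERIV_along_line grad)
    qed
    from MVT2[OF t(1) this] obtain s where s: "0 < s" "s < t" "psi t - psi 0 = t * psi' s" by auto
    let ?y = "x + t *\<^sub>R b + s *\<^sub>R a" and ?z = "x + s *\<^sub>R a"
    have y: "norm (G ?y - G x - H (?y - x)) \<le> e' * (t * C)"
      using G[of ?y] small(1)[of s] s tC e'
      by (simp add: add.commute add.left_commute) (smt (verit) mult_left_mono)
    have z: "norm (G ?z - G x - H (?z - x)) \<le> e' * (t * C)"
      using G[of ?z] small(2)[of s] s tC e' by simp (smt (verit) mult_left_mono)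
    have "H (?y - x) - H (?z - x) = t *\<^sub>R H b" by (simp add: H.add H.scaleR)
    then have "psi' s - t * (a \<bullet> H b)
        = a \<bullet> ((G ?y - G x - H (?y - x)) - (G ?z - G x - H (?z - x)))"
      unfolding psi'_def by (simp add: inner_diff_right algebra_simps flip: inner_scaleR_right)
    also have "\<bar>\<dots>\<bar> \<le> norm a * norm ((G ?y - G x - H (?y - x)) - (G ?z - G x - H (?z - x)))"
      by (rule Cauchy_Schwarz_ineq2)
    also have "\<dots> \<le> C * (2 * (e' * (t * C)))"
      using order_trans[OF norm_triangle_ineq4 add_mono[OF y z]] C
      by (intro mult_mono) (simp_all only: mult_2 norm_ge_zero less_imp_le)
    also have "\<dots> = e * t" using C by (simp add: e'_def)
    finally have "t * \<bar>psi' s - t * (a \<bullet> H b)\<bar> \<le> t * (e * t)" using t by (intro mult_left_mono) auto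
    moreover have "t * psi' s = f (x + t *\<^sub>R a + t *\<^sub>R b) - f (x + t *\<^sub>R a) - f (x + t *\<^sub>R b) + f x"
      using s(3) by (simp add: psi_def algebra_simps)
    moreover have "t * \<bar>psi' s - t * (a \<bullet> H b)\<bar> = \<bar>t * psi' s - t\<^sup>2 * (a \<bullet> H b)\<bar>"
      using t by (simp add: abs_mult_pos' right_diff_distrib power2_eq_square algebra_simps)
    ultimately show ?thesis by (simp add: power2_eq_square mult.left_commute)
  qed
  ultimately show ?thesis by blast
qed

text \<open>If the two sides differed by \<open>3 e\<close>, the same second difference could not be within
  \<open>e t\<^sup>2\<close> of both multiples of \<open>t\<^sup>2\<close>.\<close>

lemma derivative_of_gradient_symmetric:
  fixes f :: "'a::real_inner \<Rightarrow> real"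
  assumes "open U" "x \<in> U" "\<And>y. y \<in> U \<Longrightarrow> GDERIV f y :> G y"
    and "(G has_derivative H) (at x)"
  shows "a \<bullet> H b = b \<bullet> H a"
proof (rule ccontr)
  assume neq: "a \<bullet> H b \<noteq> b \<bullet> H a"
  define e where "e = \<bar>a \<bullet> H b - b \<bullet> H a\<bar> / 3"
  have e: "e > 0" using neq by (simp add: e_def)
  obtain d1 where d1: "d1 > 0" "\<And>t. 0 < t \<Longrightarrow> t < d1 \<Longrightarrow>
    \<bar>f (x + t *\<^sub>R a + t *\<^sub>R b) - f (x + t *\<^sub>R a) - f (x + t *\<^sub>R b) + f x - t\<^sup>2 * (a \<bullet> H b)\<bar>
      \<le> e * t\<^sup>2"
    using second_difference_estimate[OF assms e, of a b] by blast
  obtain d2 where d2: "d2 > 0" "\<And>t. 0 < t \<Longrightarrow> t < d2 \<Longrightarrow>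
    \<bar>f (x + t *\<^sub>R b + t *\<^sub>R a) - f (x + t *\<^sub>R b) - f (x + t *\<^sub>R a) + f x - t\<^sup>2 * (b \<bullet> H a)\<bar>
      \<le> e * t\<^sup>2"
    using second_difference_estimate[OF assms e, of b a] by blast
  define t where "t = min d1 d2 / 2"
  have t: "t > 0" "t < d1" "t < d2" using d1 d2 by (auto simp: t_def)
  have "x + t *\<^sub>R b + t *\<^sub>R a = x + t *\<^sub>R a + t *\<^sub>R b" by simp
  with d1(2)[of t] d2(2)[of t] t
  have "\<bar>t\<^sup>2 * (a \<bullet> H b) - t\<^sup>2 * (b \<bullet> H a)\<bar> \<le> 2 * (e * t\<^sup>2)" by (smt (verit))
  then have "t\<^sup>2 * \<bar>a \<bullet> H b - b \<bullet> H a\<bar> \<le> t\<^sup>2 * (2 * e)"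
    by (simp add: abs_mult_pos' flip: right_diff_distrib') (simp add: abs_mult mult.commute)
  then show False using t e by (simp add: e_def)
qed


section \<open>Tangent vectors and derivatives along a set\<close>

text \<open>Membership in the adjacent tangent cone (also called derivable cone): the ray from \<open>x\<close> in
  direction \<open>a\<close> is approximated by points of \<open>S\<close> to first order.\<close>

definition tangent_vector :: "'a::real_normed_vector set \<Rightarrow> 'a \<Rightarrow> 'a \<Rightarrow> bool" where
  "tangent_vector S x a \<longleftrightarrow>
     (\<forall>e>0. \<exists>d>0. \<forall>t. 0 < t \<and> t < d \<longrightarrow> (\<exists>y\<in>S. norm (y - (x + t *\<^sub>R a)) \<le> e * t))"

text \<open>A point \<open>y\<close> of the set near \<open>x + t a\<close> has \<open>D (y - x) = o(t)\<close> because \<open>D\<close> approximates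
  the zero function, and \<open>D (y - x)\<close> differs from \<open>t D a\<close> by \<open>o(t)\<close>.\<close>

lemma derivative_zero_on_tangent_vector:
  assumes D: "((\<lambda>y. 0) has_derivative D) (at x within S)" and a: "tangent_vector S x a"
  shows "D a = 0"
proof (rule ccontr)
  assume nz: "D a \<noteq> 0"
  interpret D: bounded_linear D using has_derivative_bounded_linear[OF D] .
  obtain K where K: "K > 0" "\<And>v. norm (D v) \<le> norm v * K" using D.pos_bounded by blast
  define C where "C = norm a + 1 + K"
  have C: "C > 0" using K by (simp add: C_def add_nonneg_pos)
  \<comment> \<open>The argument below yields \<open>norm (D a) \<le> e * C\<close>; this \<open>e\<close> makes that impossible.\<close>
  define e where "e = min 1 (norm (D a) / (2 * C))"
  have e: "e > 0" "e \<le> 1" using nz C by (auto simp: e_def)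
  have eC: "e * C \<le> norm (D a) / 2"
  proof -
    have "e \<le> norm (D a) / (2 * C)" by (simp add: e_def)
    then show ?thesis using C by (simp add: field_simps)
  qed
  obtain d where d: "d > 0"
    and Dd: "\<And>y. y \<in> S \<Longrightarrow> norm (y - x) < d \<Longrightarrow> norm (D (y - x)) \<le> e * norm (y - x)"
  proof -
    have "\<exists>d>0. \<forall>y\<in>S. norm (y - x) < d \<longrightarrow> norm (0 - 0 - D (y - x)) \<le> e * norm (y - x)"
      using D e unfolding has_derivative_within_alt by blast
    then show ?thesis using that by (metis diff_0 diff_self norm_minus_cancel)
  qed
  obtain d' where d': "d' > 0"
    and S: "\<And>t. 0 < t \<Longrightarrow> t < d' \<Longrightarrow> \<exists>y\<in>S. norm (y - (x + t *\<^sub>R a)) \<le> e * t"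
    using a[unfolded tangent_vector_def, rule_format, OF e(1)] by blast
  define t where "t = min (d' / 2) (d / (2 * (norm a + 1)))"
  have na: "norm a + 1 > 0" by (simp add: add_nonneg_pos)
  have t: "t > 0" "t < d'" using d d' na by (auto simp: t_def)
  have "t \<le> d / (2 * (norm a + 1))" by (simp add: t_def)
  then have td: "t * (norm a + 1) < d" using d na by (simp add: field_simps)
  obtain y where y: "y \<in> S" "norm (y - (x + t *\<^sub>R a)) \<le> e * t" using S t by blast
  define w where "w = y - (x + t *\<^sub>R a)"
  have yx: "y - x = t *\<^sub>R a + w" by (simp add: w_def)
  have w: "norm w \<le> e * t" using y by (simp add: w_def)
  have "norm (y - x) \<le> t * norm a + e * t"
    unfolding yx using norm_triangle_ineq[of "t *\<^sub>R a" w] w t by simp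
  also have "\<dots> \<le> t * (norm a + 1)" using e t by (simp add: algebra_simps)
  finally have yx_le: "norm (y - x) \<le> t * (norm a + 1)" .
  have "t *\<^sub>R D a = D (y - x) - D w" unfolding yx by (simp add: D.add D.scaleR)
  then have "t * norm (D a) = norm (D (y - x) - D w)" using t by (metis norm_scaleR abs_of_pos)
  also have "\<dots> \<le> norm (D (y - x)) + norm (D w)" by (rule norm_triangle_ineq4)
  also have "\<dots> \<le> e * (t * (norm a + 1)) + e * t * K"
  proof (rule add_mono)
    have "norm (D (y - x)) \<le> e * norm (y - x)" using Dd[OF y(1)] yx_le td by simp
    also have "\<dots> \<le> e * (t * (norm a + 1))" using yx_le e by (simp add: mult_left_mono)
    finally show "norm (D (y - x)) \<le> e * (t * (norm a + 1))" .
    show "norm (D w) \<le> e * t * K" using K(2)[of w] mult_right_mono[OF w less_imp_le[OF K(1)]] by (rule order_trans)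
  qed
  also have "\<dots> = t * (e * C)" by (simp add: C_def algebra_simps)
  finally have "norm (D a) \<le> e * C" using t by simp
  moreover have "norm (D a) > 0" using nz by simp
  ultimately show False using eC by linarith
qed

text \<open>The Frechet derivative within a thin set is an arbitrary choice among linear maps, but two
  such maps differ by a derivative of the zero function.\<close>

lemma frechet_derivative_tangent_vector:
  assumes f: "(f has_derivative A) (at x within S)" and a: "tangent_vector S x a"
  shows "frechet_derivative f (at x within S) a = A a"
proof -
  have "(f has_derivative frechet_derivative f (at x within S)) (at x within S)"
    using f frechet_derivative_works differentiableI by blast
  from has_derivative_diff[OF this f]
  have "((\<lambda>y. 0) has_derivative (\<lambda>h. frechet_derivative f (at x within S) h - A h)) (at x within S)"
    by simp
  from derivative_zero_on_tangent_vector[OF this a] show ?thesis by simp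
qed

text \<open>A level set of a function with derivative \<open>g\<close> is tangent to every direction orthogonal to
  \<open>g\<close>: on the short segment of points \<open>x + t (a + s g)\<close>, \<open>\<bar>s\<bar> \<le> c\<close>, the function changes sign,
  so it vanishes somewhere by the intermediate value theorem.\<close>

lemma tangent_vector_level_set:
  fixes f :: "'a::real_inner \<Rightarrow> real"
  assumes U: "open U" "x \<in> U" and cont: "continuous_on U f"
    and f: "GDERIV f x :> g" "f x = 0" "g \<noteq> 0" and a: "a \<bullet> g = 0"
  shows "tangent_vector {y \<in> U. f y = 0} x a"
  unfolding tangent_vector_def
proof (intro allI impI)
  fix e :: real assume "e > 0"
  \<comment> \<open>With this bound on \<open>\<bar>s\<bar>\<close>, the term \<open>s g\<close> has length at most \<open>e\<close>.\<close>
  define c where "c = e / norm g"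
  have c: "c > 0" using \<open>e > 0\<close> f by (simp add: c_def)
  have der: "((\<lambda>t. f (x + t *\<^sub>R v)) has_real_derivative v \<bullet> g) (at 0)" for v
    using GDERIV_along_line[of f x 0 v g] f by simp
  have "(a + c *\<^sub>R g) \<bullet> g > 0" "(a - c *\<^sub>R g) \<bullet> g < 0"
    using a c f by (simp_all add: inner_add_left inner_diff_left)
  from DERIV_pos_inc_right[OF der this(1)] DERIV_neg_dec_right[OF der this(2)] f(2)
  obtain d1 d2 where d12: "d1 > 0" "\<And>t. 0 < t \<Longrightarrow> t < d1 \<Longrightarrow> f (x + t *\<^sub>R (a + c *\<^sub>R g)) > 0"
    "d2 > 0" "\<And>t. 0 < t \<Longrightarrow> t < d2 \<Longrightarrow> f (x + t *\<^sub>R (a - c *\<^sub>R g)) < 0"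
    by auto
  obtain r where r: "r > 0" "ball x r \<subseteq> U" using U open_contains_ball by blast
  define C where "C = norm a + e"
  have C: "C > 0" using \<open>e > 0\<close> by (simp add: C_def add_nonneg_pos)
  define d where "d = min (min d1 d2) (r / C)"
  have "d > 0" using d12 r C by (simp add: d_def)
  moreover have "\<exists>y\<in>{y \<in> U. f y = 0}. norm (y - (x + t *\<^sub>R a)) \<le> e * t" if t: "0 < t" "t < d" for t
  proof -
    have inU: "x + t *\<^sub>R (a + s *\<^sub>R g) \<in> U" if "- c \<le> s" "s \<le> c" for s
    proof -
      have "norm (a + s *\<^sub>R g) \<le> norm a + \<bar>s\<bar> * norm g" using norm_triangle_ineq[of a "s *\<^sub>R g"] by simp
      also have "\<dots> \<le> norm a + c * norm g" using that by (simp add: mult_right_mono abs_le_iff)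
      also have "\<dots> = C" using f by (simp add: c_def C_def)
      finally have "t * norm (a + s *\<^sub>R g) \<le> t * C" using t by simp
      also have "\<dots> < r" using t C by (simp add: d_def field_simps)
      finally show ?thesis using r t by (auto simp: dist_norm subset_iff)
    qed
    define h where "h s = f (x + t *\<^sub>R (a + s *\<^sub>R g))" for s
    have "continuous_on {-c..c} h"
      unfolding h_def by (rule continuous_on_compose2[OF cont]) (auto intro!: continuous_intros inU)
    moreover have "h (-c) < 0" "h c > 0" using d12 t by (auto simp: h_def d_def)
    ultimately obtain s where s: "-c \<le> s" "s \<le> c" "h s = 0"
      using IVT'[of h "-c" 0 c] c by auto
    have "\<bar>s\<bar> * norm g \<le> e" using s f by (simp add: c_def abs_le_iff field_simps)
    then have "norm (x + t *\<^sub>R (a + s *\<^sub>R g) - (x + t *\<^sub>R a)) \<le> e * t"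
    proof -
      have "x + t *\<^sub>R (a + s *\<^sub>R g) - (x + t *\<^sub>R a) = t *\<^sub>R (s *\<^sub>R g)" by (simp add: scaleR_add_right)
      then have "norm (x + t *\<^sub>R (a + s *\<^sub>R g) - (x + t *\<^sub>R a)) = t * (\<bar>s\<bar> * norm g)" using t by (simp add: abs_mult)
      also have "\<dots> \<le> t * e" using \<open>\<bar>s\<bar> * norm g \<le> e\<close> t by (intro mult_left_mono) auto
      finally show ?thesis by (simp add: mult.commute)
    qed
    then show ?thesis using inU s by (intro bexI[of _ "x + t *\<^sub>R (a + s *\<^sub>R g)"]) (auto simp: h_def)
  qed
  ultimately show "\<exists>d>0. \<forall>t. 0 < t \<and> t < d \<longrightarrow>
      (\<exists>y\<in>{y \<in> U. f y = 0}. norm (y - (x + t *\<^sub>R a)) \<le> e * t)"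
    by blast
qed

lemma tangent_vector_mono: "tangent_vector S x a \<Longrightarrow> S \<subseteq> T \<Longrightarrow> tangent_vector T x a"
  unfolding tangent_vector_def by (meson subsetD)


section \<open>The normal field near a boundary point\<close>

text \<open>If the gradients were not positively parallel, some direction would enter the set
  where one function is negative and the set where the other is positive at the same time.\<close>

lemma local_defining_functions_same_direction:
  assumes phi: "local_defining_function \<Omega> U \<phi>" and psi: "local_defining_function \<Omega> V \<psi>"
    and x: "x \<in> U" "x \<in> V" "x \<in> frontier \<Omega>"
    and g: "GDERIV \<phi> x :> g" and h: "GDERIV \<psi> x :> h" "g \<noteq> 0" "h \<noteq> 0"
  shows "g /\<^sub>R norm g = h /\<^sub>R norm h"
proof (rule ccontr)
  define m n where "m = g /\<^sub>R norm g" and "n = h /\<^sub>R norm h"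
  assume "g /\<^sub>R norm g \<noteq> h /\<^sub>R norm h"
  then have "m \<noteq> n" by (simp add: m_def n_def)
  have unit: "norm m = 1" "norm n = 1" using h by (auto simp: m_def n_def)
  have gh: "g = norm g *\<^sub>R m" "h = norm h *\<^sub>R n" using h by (auto simp: m_def n_def)
  have "0 < (norm (m - n))\<^sup>2" using \<open>m \<noteq> n\<close> by simp
  also have "(norm (m - n))\<^sup>2 = 2 - 2 * (m \<bullet> n)"
    using unit by (simp add: power2_norm_eq_inner inner_diff_left inner_diff_right inner_commute norm_eq_1)
  finally have mn: "m \<bullet> n < 1" by simp
  \<comment> \<open>The direction \<open>n - m\<close> decreases \<open>\<phi>\<close> and increases \<open>\<psi>\<close>.\<close>
  have "(n - m) \<bullet> m < 0" "(n - m) \<bullet> n > 0"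
    using mn unit by (simp_all add: inner_diff_left norm_eq_1) (simp_all add: inner_commute)
  then have "(n - m) \<bullet> (norm g *\<^sub>R m) < 0" "(n - m) \<bullet> (norm h *\<^sub>R n) > 0"
    using h by (simp_all only: inner_scaleR_right mult_pos_neg mult_pos_pos zero_less_norm_iff not_False_eq_True)
  then have sg: "(n - m) \<bullet> g < 0" "(n - m) \<bullet> h > 0" by (simp_all only: gh[symmetric])
  have der: "((\<lambda>t. \<phi> (x + t *\<^sub>R (n - m))) has_real_derivative (n - m) \<bullet> g) (at 0)"
    "((\<lambda>t. \<psi> (x + t *\<^sub>R (n - m))) has_real_derivative (n - m) \<bullet> h) (at 0)"
    using GDERIV_along_line[of \<phi> x 0 "n - m" g] GDERIV_along_line[of \<psi> x 0 "n - m" h] g h by auto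
  have zero: "\<phi> x = 0" "\<psi> x = 0" using phi psi x unfolding local_defining_function_def by auto
  obtain d1 where d1: "d1 > 0" "\<And>t. 0 < t \<Longrightarrow> t < d1 \<Longrightarrow> \<phi> (x + t *\<^sub>R (n - m)) < 0"
    using DERIV_neg_dec_right[OF der(1) sg(1)] zero by auto
  obtain d2 where d2: "d2 > 0" "\<And>t. 0 < t \<Longrightarrow> t < d2 \<Longrightarrow> \<psi> (x + t *\<^sub>R (n - m)) > 0"
    using DERIV_pos_inc_right[OF der(2) sg(2)] zero by auto
  have "open (U \<inter> V)" using phi psi unfolding local_defining_function_def smooth_map_on_def by auto
  then obtain r where r: "r > 0" "ball x r \<subseteq> U \<inter> V" using x open_contains_ball by blast
  define t where "t = min (min d1 d2) (r / norm (n - m)) / 2"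
  have nm: "norm (n - m) > 0" using \<open>m \<noteq> n\<close> by simp
  have "r / norm (n - m) > 0" using r nm by simp
  then have "0 < 2 * t" "2 * t \<le> d1" "2 * t \<le> d2" "2 * t \<le> r / norm (n - m)"
    using d1(1) d2(1) by (auto simp: t_def)
  then have t: "t > 0" "t < d1" "t < d2" "t < r / norm (n - m)" by linarith+
  have "t * norm (n - m) < r" using t(4) nm by (simp add: field_simps)
  then have "x + t *\<^sub>R (n - m) \<in> U \<inter> V" using r t by (intro subsetD[OF r(2)]) (simp add: dist_norm)
  then have "\<phi> (x + t *\<^sub>R (n - m)) < 0 \<longleftrightarrow> \<psi> (x + t *\<^sub>R (n - m)) < 0"
    using phi psi unfolding local_defining_function_def by blast
  then show False using d1(2)[OF t(1,2)] d2(2)[OF t(1,3)] by simp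
qed

locale boundary_chart =
  fixes \<Omega> U :: "(real^3) set" and \<phi> :: "real^3 \<Rightarrow> real"
  assumes open_domain: "open \<Omega>" and chart: "local_defining_function \<Omega> U \<phi>"
begin

definition chart_normal :: "real^3 \<Rightarrow> real^3" where
  "chart_normal x = gradient \<phi> x /\<^sub>R norm (gradient \<phi> x)"

lemma open_chart: "open U"
  using chart unfolding local_defining_function_def smooth_map_on_def by blast

lemma chart_smooth: "smooth_map_on \<phi> U"
  using chart unfolding local_defining_function_def by blast

lemma GDERIV_chart: "x \<in> U \<Longrightarrow> GDERIV \<phi> x :> gradient \<phi> x"
  by (rule GDERIV_gradient) (rule smooth_map_on_has_derivative[OF chart_smooth])

lemma gradient_chart_nonzero: "x \<in> U \<Longrightarrow> gradient \<phi> x \<noteq> 0"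
  using chart GDERIV_unique[OF GDERIV_chart] unfolding local_defining_function_def by blast

lemma smooth_gradient_chart: "smooth_map_on (gradient \<phi>) U"
  by (rule smooth_map_on_gradient[OF chart_smooth])

lemma smooth_chart_normal: "smooth_map_on chart_normal U"
  unfolding chart_normal_def by (rule smooth_map_on_unit[OF smooth_gradient_chart gradient_chart_nonzero])

lemma norm_chart_normal: "x \<in> U \<Longrightarrow> norm (chart_normal x) = 1"
  using gradient_chart_nonzero by (simp add: chart_normal_def)

lemma orthogonal_chart_normal_iff: "x \<in> U \<Longrightarrow> a \<bullet> chart_normal x = 0 \<longleftrightarrow> a \<bullet> gradient \<phi> x = 0"
  using gradient_chart_nonzero by (simp add: chart_normal_def)

text \<open>This resolves the definite description in \<open>outward_normal\<close>, and it shows that on the surface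
  the outward normal is the restriction of a smooth field defined on an open set.\<close>

lemma outward_normal_eq_chart_normal:
  assumes "x \<in> U" "x \<in> frontier \<Omega>"
  shows "outward_normal \<Omega> x = chart_normal x"
  unfolding outward_normal_def
proof (rule the_equality)
  show "\<exists>V \<psi> g. x \<in> V \<and> local_defining_function \<Omega> V \<psi> \<and> GDERIV \<psi> x :> g \<and>
      chart_normal x = g /\<^sub>R norm g"
    using assms chart GDERIV_chart chart_normal_def by blast
  fix n assume "\<exists>V \<psi> g. x \<in> V \<and> local_defining_function \<Omega> V \<psi> \<and> GDERIV \<psi> x :> g \<and> n = g /\<^sub>R norm g"
  then obtain V \<psi> g where V: "x \<in> V" "local_defining_function \<Omega> V \<psi>" "GDERIV \<psi> x :> g"
    "n = g /\<^sub>R norm g" by blast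
  have "g \<noteq> 0" using V GDERIV_unique[OF V(3)] unfolding local_defining_function_def by blast
  then show "n = chart_normal x"
    unfolding V(4) chart_normal_def
    using local_defining_functions_same_direction[OF V(2) chart V(1) assms V(3) GDERIV_chart]
      gradient_chart_nonzero assms by blast
qed

lemma tangent_vector_frontier:
  assumes "x \<in> U" "x \<in> frontier \<Omega>" "a \<in> tangent_plane \<Omega> x"
  shows "tangent_vector (frontier \<Omega>) x a"
proof -
  have eq: "frontier \<Omega> \<inter> U = {y \<in> U. \<phi> y = 0}"
    using chart unfolding local_defining_function_def by blast
  have "a \<bullet> gradient \<phi> x = 0"
    using assms orthogonal_chart_normal_iff outward_normal_eq_chart_normal by (simp add: tangent_plane_def)
  then have "tangent_vector {y \<in> U. \<phi> y = 0} x a"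
    using assms eq gradient_chart_nonzero smooth_map_on_continuous[OF chart_smooth]
    by (intro tangent_vector_level_set[OF open_chart _ _ GDERIV_chart]) auto
  then show ?thesis unfolding eq[symmetric] by (rule tangent_vector_mono) blast
qed

lemma surface_deriv_eq:
  assumes "x \<in> U" "x \<in> frontier \<Omega>" "a \<in> tangent_plane \<Omega> x"
    and "(f has_derivative A) (at x within frontier \<Omega>)"
  shows "surface_deriv \<Omega> f x a = A a"
  unfolding surface_deriv_def
  by (rule frechet_derivative_tangent_vector[OF assms(4) tangent_vector_frontier[OF assms(1-3)]])

lemma outward_normal_has_derivative:
  assumes "x \<in> U" "x \<in> frontier \<Omega>"
  shows "(outward_normal \<Omega> has_derivative frechet_derivative chart_normal (at x)) (at x within frontier \<Omega>)"
proof -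
  have der: "(chart_normal has_derivative frechet_derivative chart_normal (at x)) (at x within frontier \<Omega>)"
    using smooth_map_on_has_derivative[OF smooth_chart_normal assms(1)] has_derivative_at_withinI by blast
  obtain r where r: "r > 0" "ball x r \<subseteq> U" using open_chart assms(1) open_contains_ball by blast
  have "chart_normal y = outward_normal \<Omega> y" if "y \<in> frontier \<Omega>" "dist y x < r" for y
    using outward_normal_eq_chart_normal[of y] r that by (auto simp: dist_commute subset_iff)
  with der show ?thesis
    by (rule has_derivative_transform_within[OF _ r(1) assms(2)])
qed

text \<open>Differentiate \<open>\<langle>n, n\<rangle> = 1\<close>.\<close>

lemma chart_normal_derivative_tangential:
  assumes "x \<in> U"
  shows "frechet_derivative chart_normal (at x) a \<bullet> chart_normal x = 0"
proof -
  let ?D = "frechet_derivative chart_normal (at x)"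
  have D: "(chart_normal has_derivative ?D) (at x)"
    using smooth_map_on_has_derivative[OF smooth_chart_normal assms] .
  have "((\<lambda>y. chart_normal y \<bullet> chart_normal y) has_derivative
      (\<lambda>h. chart_normal x \<bullet> ?D h + ?D h \<bullet> chart_normal x)) (at x)"
    using has_derivative_inner[OF D D] .
  then have "((\<lambda>y. 1) has_derivative (\<lambda>h. chart_normal x \<bullet> ?D h + ?D h \<bullet> chart_normal x)) (at x)"
    by (rule has_derivative_transform_within_open[OF _ open_chart assms])
      (simp add: norm_chart_normal flip: norm_eq_1)
  from has_derivative_unique[OF this has_derivative_const]
  have "chart_normal x \<bullet> ?D a + ?D a \<bullet> chart_normal x = 0" by metis
  then show ?thesis by (simp add: inner_commute)
qed

text \<open>On tangent vectors the derivative of the unit normal is the Hessian of the defining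
  function divided by \<open>|\<nabla>\<phi>|\<close>: the derivative of the normalising factor only contributes in the
  normal direction.\<close>

lemma chart_normal_derivative_symmetric:
  assumes "x \<in> U" "a \<bullet> chart_normal x = 0" "b \<bullet> chart_normal x = 0"
  shows "frechet_derivative chart_normal (at x) a \<bullet> b = frechet_derivative chart_normal (at x) b \<bullet> a"
proof -
  let ?G = "gradient \<phi>" and ?H = "frechet_derivative (gradient \<phi>) (at x)"
  have G: "(?G has_derivative ?H) (at x)"
    using smooth_map_on_has_derivative[OF smooth_gradient_chart assms(1)] .
  have "((\<lambda>y. norm (?G y)) has_derivative (\<lambda>h. ?H h \<bullet> sgn (?G x))) (at x)"
    using has_derivative_compose[OF G has_derivative_norm[OF gradient_chart_nonzero[OF assms(1)]]] .
  from Deriv.has_derivative_inverse[OF _ this] gradient_chart_nonzero[OF assms(1)]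
  obtain R where "((\<lambda>y. inverse (norm (?G y))) has_derivative R) (at x)" by auto
  from has_derivative_scaleR[OF this G]
  have "(chart_normal has_derivative (\<lambda>h. inverse (norm (?G x)) *\<^sub>R ?H h + R h *\<^sub>R ?G x)) (at x)"
    by (simp add: chart_normal_def[abs_def])
  from frechet_derivative_at[OF this]
  have Dfun: "(\<lambda>h. inverse (norm (?G x)) *\<^sub>R ?H h + R h *\<^sub>R ?G x)
      = frechet_derivative chart_normal (at x)" .
  have D: "frechet_derivative chart_normal (at x) h = inverse (norm (?G x)) *\<^sub>R ?H h + R h *\<^sub>R ?G x" for h
    by (simp only: fun_cong[OF Dfun, symmetric])
  have "a \<bullet> ?G x = 0" "b \<bullet> ?G x = 0" using assms orthogonal_chart_normal_iff by auto
  then show ?thesis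
    using derivative_of_gradient_symmetric[OF open_chart assms(1) GDERIV_chart G, of a b]
    by (simp add: D inner_commute[of _ a] inner_commute[of _ b] inner_add_right)
qed

lemma surface_deriv_outward_normal:
  assumes "x \<in> U" "x \<in> frontier \<Omega>" "a \<in> tangent_plane \<Omega> x"
  shows "surface_deriv \<Omega> (outward_normal \<Omega>) x a = frechet_derivative chart_normal (at x) a"
  using surface_deriv_eq[OF assms outward_normal_has_derivative[OF assms(1,2)]] .

end


section \<open>Fields that are continuously differentiable up to the boundary\<close>

text \<open>The estimate behind differentiability at a boundary point: along a segment that runs in
  the open set, except for its starting point, the increment of \<open>u\<close> is controlled by the
  oscillation of the derivative. Continuity of \<open>u\<close> at the starting point is enough for the mean
  value inequality.\<close>

lemma segment_increment_estimate:
  fixes u :: "'a::real_normed_vector \<Rightarrow> 'b::real_inner"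
  assumes cont: "continuous_on (closure S) u"
    and der: "\<And>w. w \<in> S \<Longrightarrow> (u has_derivative A w) (at w)"
    and z: "z \<in> closure S" and seg: "\<And>t. 0 < t \<Longrightarrow> t \<le> 1 \<Longrightarrow> z + t *\<^sub>R v \<in> S"
    and M: "bounded_linear M"
    and close: "\<And>t. 0 < t \<Longrightarrow> t < 1 \<Longrightarrow> norm (A (z + t *\<^sub>R v) v - M v) \<le> c"
  shows "norm (u (z + v) - u z - M v) \<le> c"
proof -
  define f where "f t = u (z + t *\<^sub>R v) - t *\<^sub>R M v" for t :: real
  have incl: "z + t *\<^sub>R v \<in> closure S" if "0 \<le> t" "t \<le> 1" for t
    using that seg[of t] z closure_subset by (cases "t = 0") auto
  have "continuous_on {0..1} f" unfolding f_def
    by (intro continuous_on_diff continuous_on_compose2[OF cont])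
      (auto intro!: continuous_intros incl)
  moreover have "(f has_derivative (\<lambda>h. h *\<^sub>R (A (z + t *\<^sub>R v) v - M v))) (at t)" if t: "0 < t" "t < 1" for t
  proof -
    note d = der[OF seg[of t]]
    have "((\<lambda>t. z + t *\<^sub>R v) has_derivative (\<lambda>h. h *\<^sub>R v)) (at t)"
      by (auto intro!: derivative_eq_intros)
    from has_derivative_compose[OF this d] t
    have "((\<lambda>t. u (z + t *\<^sub>R v)) has_derivative (\<lambda>h. A (z + t *\<^sub>R v) (h *\<^sub>R v))) (at t)" by simp
    moreover have "A (z + t *\<^sub>R v) (h *\<^sub>R v) = h *\<^sub>R A (z + t *\<^sub>R v) v" for h
      using has_derivative_linear[OF d] t by (simp add: linear_scale)
    ultimately show ?thesis unfolding f_def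
      by (auto intro!: derivative_eq_intros simp: scaleR_diff_right)
  qed
  ultimately obtain t where t: "t \<in> {0<..<1}"
    "norm (f 1 - f 0) \<le> norm ((1 - 0) *\<^sub>R (A (z + t *\<^sub>R v) v - M v))"
    using mvt_general[of 0 1 f "\<lambda>t h. h *\<^sub>R (A (z + t *\<^sub>R v) v - M v)"] by auto
  then show ?thesis using close[of t] by (simp add: f_def algebra_simps)
qed

context boundary_chart
begin

text \<open>A uniform interior cone condition. It holds because the gradient of the defining function is
  continuous: near \<open>p\<close> the function decreases strictly in every direction of the cone. The
  opening constant \<open>1/3\<close> suits the polygonal path used in the next lemma.\<close>

lemma interior_cone:
  assumes p: "p \<in> U" "p \<in> frontier \<Omega>"
  obtains r where "r > 0"
    "\<And>z v. z \<in> closure \<Omega> \<Longrightarrow> norm (z - p) < r \<Longrightarrow> v \<noteq> 0 \<Longrightarrow> norm v < r \<Longrightarrow>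
       v \<bullet> outward_normal \<Omega> p \<le> - (norm v / 3) \<Longrightarrow> z + v \<in> \<Omega>"
proof -
  let ?G = "gradient \<phi>" and ?n = "outward_normal \<Omega> p"
  have n: "?G p = norm (?G p) *\<^sub>R ?n"
    using gradient_chart_nonzero p by (simp add: outward_normal_eq_chart_normal chart_normal_def)
  have pos: "norm (?G p) > 0" using gradient_chart_nonzero p by simp
  obtain r1 where r1: "r1 > 0" "ball p r1 \<subseteq> U" using open_chart p open_contains_ball by blast
  have "continuous (at p) ?G"
    using smooth_map_on_continuous[OF smooth_gradient_chart] open_chart p
    by (simp add: continuous_on_eq_continuous_at)
  then obtain r2 where r2: "r2 > 0" "\<And>w. dist w p < r2 \<Longrightarrow> dist (?G w) (?G p) < norm (?G p) / 3"
    unfolding continuous_at_eps_delta dist_norm using pos by (metis divide_pos_pos zero_less_numeral)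
  define r where "r = min r1 r2 / 2"
  have "r > 0" using r1 r2 by (simp add: r_def)
  moreover have "z + v \<in> \<Omega>" if z: "z \<in> closure \<Omega>" "norm (z - p) < r"
    and v: "v \<noteq> 0" "norm v < r" "v \<bullet> ?n \<le> - (norm v / 3)" for z v
  proof -
    have near: "z + t *\<^sub>R v \<in> U" "dist (z + t *\<^sub>R v) p < r2" if "0 \<le> t" "t \<le> 1" for t
    proof -
      have "norm (z + t *\<^sub>R v - p) \<le> norm (z - p) + t * norm v"
        using norm_triangle_ineq[of "z - p" "t *\<^sub>R v"] that by (simp add: algebra_simps)
      also have "\<dots> \<le> norm (z - p) + norm v" using that by (simp add: mult_left_le_one_le)
      also have "\<dots> < min r1 r2" using z v by (simp add: r_def)
      finally show "z + t *\<^sub>R v \<in> U" "dist (z + t *\<^sub>R v) p < r2"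
        using r1 by (auto simp: dist_norm norm_minus_commute subset_iff)
    qed
    define D where "D t = v \<bullet> ?G (z + t *\<^sub>R v)" for t
    have der: "((\<lambda>t. \<phi> (z + t *\<^sub>R v)) has_real_derivative D t) (at t)" if "0 \<le> t" "t \<le> 1" for t
      unfolding D_def by (rule GDERIV_along_line[OF GDERIV_chart[OF near(1)[OF that]]])
    obtain t where t: "0 < t" "t < 1" "\<phi> (z + 1 *\<^sub>R v) - \<phi> (z + 0 *\<^sub>R v) = (1 - 0) * D t"
      using MVT2[of 0 1 "\<lambda>t. \<phi> (z + t *\<^sub>R v)" D] der by auto
    have "D t = norm (?G p) * (v \<bullet> ?n) + v \<bullet> (?G (z + t *\<^sub>R v) - ?G p)"
      unfolding D_def by (subst (2) n) (simp add: inner_diff_right)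
    also have "norm (?G p) * (v \<bullet> ?n) \<le> norm (?G p) * - (norm v / 3)"
      using v by (intro mult_left_mono) auto
    also have "v \<bullet> (?G (z + t *\<^sub>R v) - ?G p) \<le> norm v * norm (?G (z + t *\<^sub>R v) - ?G p)"
      by (rule norm_cauchy_schwarz)
    also have "norm v * norm (?G (z + t *\<^sub>R v) - ?G p) < norm v * (norm (?G p) / 3)"
      using r2(2) near(2)[of t] t v by (intro mult_strict_left_mono) (auto simp: dist_norm)
    finally have "D t < 0" by simp
    moreover have "z \<in> U" using near(1)[of 0] by simp
    then have "z \<in> {x \<in> U. \<phi> x < 0} \<union> {x \<in> U. \<phi> x = 0}"
      using z(1) chart closure_Un_frontier[of \<Omega>] unfolding local_defining_function_def by blast
    then have "\<phi> z \<le> 0" by auto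
    ultimately have "\<phi> (z + v) < 0" using t by simp
    moreover have "z + v \<in> U" using near(1)[of 1] by simp
    ultimately show ?thesis using chart unfolding local_defining_function_def by blast
  qed
  ultimately show ?thesis using that by blast
qed

text \<open>To compare \<open>u\<close> at a boundary point \<open>p\<close> and at a nearby point \<open>y\<close> of the closed domain,
  connect both to the interior point \<open>q = p - 2 |y - p| n\<close>. Both segments leave their boundary
  end in a direction of the interior cone, and their lengths are comparable to \<open>|y - p|\<close>.\<close>

lemma C1_on_closure_has_derivative:
  assumes C1: "C1_on_closure \<Omega> u" and p: "p \<in> U" "p \<in> frontier \<Omega>"
  shows "(u has_derivative (\<lambda>h. ext_jacobian \<Omega> u p *v h)) (at p within closure \<Omega>)"
proof -
  obtain J where cont: "continuous_on (closure \<Omega>) u" and diff: "u differentiable_on \<Omega>"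
    and J: "continuous_on (closure \<Omega>) J" "\<And>x. x \<in> \<Omega> \<Longrightarrow> J x = jacobian u (at x)"
    using C1 unfolding C1_on_closure_def by blast
  have p': "p \<in> closure \<Omega>" "p \<notin> \<Omega>" using p(2) open_domain by (auto simp: frontier_def interior_open)
  have "(J \<longlongrightarrow> J p) (at p within closure \<Omega>)" using J(1) p' by (simp add: continuous_on)
  then have "(J \<longlongrightarrow> J p) (at p within \<Omega>)" using closure_subset by (rule tendsto_within_subset)
  then have "((\<lambda>y. jacobian u (at y)) \<longlongrightarrow> J p) (at p within \<Omega>)"
    using J(2) by (elim Lim_transform_eventually) (auto simp: eventually_at_filter)
  moreover have "at p within \<Omega> \<noteq> bot" using p' by (simp add: trivial_limit_within islimpt_in_closure)
  ultimately have Jp: "ext_jacobian \<Omega> u p = J p" unfolding ext_jacobian_def by (intro tendsto_Lim)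
  have der: "(u has_derivative (*v) (J w)) (at w)" if "w \<in> \<Omega>" for w
    using that diff J(2) open_domain jacobian_works[of u "at w"]
    by (simp add: differentiable_on_eq_differentiable_at)
  obtain K where K: "K > 0" "\<And>(M :: real^3^3) v. norm (M *v v) \<le> norm M * norm v * K"
    using bounded_bilinear.pos_bounded[OF bounded_bilinear_matrix_vector_mult] by blast
  let ?n = "outward_normal \<Omega> p"
  have n: "norm ?n = 1" using p norm_chart_normal outward_normal_eq_chart_normal by simp
  obtain r where r: "r > 0" and cone: "\<And>z v. z \<in> closure \<Omega> \<Longrightarrow> norm (z - p) < r \<Longrightarrow> v \<noteq> 0 \<Longrightarrow>
      norm v < r \<Longrightarrow> v \<bullet> ?n \<le> - (norm v / 3) \<Longrightarrow> z + v \<in> \<Omega>"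
    using interior_cone[OF p] by blast
  have "\<exists>d>0. \<forall>y\<in>closure \<Omega>. norm (y - p) < d \<longrightarrow> norm (u y - u p - J p *v (y - p)) \<le> e * norm (y - p)"
    if e: "e > 0" for e
  proof -
    \<comment> \<open>The two segments have total length at most \<open>5 |y - p|\<close>, and \<open>K\<close> converts the norm of a
      matrix into a bound for its action.\<close>
    define e' where "e' = e / (5 * K)"
    have e': "e' > 0" using e K by (simp add: e'_def)
    obtain d1 where d1: "d1 > 0" "\<And>w. w \<in> closure \<Omega> \<Longrightarrow> dist w p < d1 \<Longrightarrow> dist (J w) (J p) < e'"
      using J(1) p'(1) e' unfolding continuous_on_iff by meson
    define d where "d = min r d1 / 4"
    have d: "d > 0" "4 * d \<le> r" "4 * d \<le> d1" using r d1 by (simp_all add: d_def)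
    have increment: "norm (u (z + v) - u z - J p *v v) \<le> e' * K * norm v"
      and inside: "z + v \<in> \<Omega>"
      if z: "z \<in> closure \<Omega>" "norm (z - p) < d" and v: "v \<noteq> 0" "norm v < 3 * d"
        "v \<bullet> ?n \<le> - (norm v / 3)" for z v
    proof -
      have seg: "z + t *\<^sub>R v \<in> \<Omega>" if "0 < t" "t \<le> 1" for t
      proof (rule cone)
        have "t * norm v \<le> norm v" using that by (simp add: mult_left_le_one_le)
        moreover have "norm (t *\<^sub>R v) = t * norm v" using that by simp
        ultimately show "norm (t *\<^sub>R v) < r" using v d by linarith
        show "(t *\<^sub>R v) \<bullet> ?n \<le> - (norm (t *\<^sub>R v) / 3)"
          using mult_left_mono[OF v(3), of t] that by simp
        show "norm (z - p) < r" using z(2) d by linarith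
        show "t *\<^sub>R v \<noteq> 0" using v(1) that by simp
      qed (rule z(1))
      show "z + v \<in> \<Omega>" using seg[of 1] by simp
      show "norm (u (z + v) - u z - J p *v v) \<le> e' * K * norm v"
      proof (rule segment_increment_estimate[OF cont der z(1) seg matrix_vector_mul_bounded_linear])
        fix t :: real assume t: "0 < t" "t < 1"
        have "norm (z + t *\<^sub>R v - p) \<le> norm (z - p) + t * norm v"
          using norm_triangle_ineq[of "z - p" "t *\<^sub>R v"] t by (simp add: algebra_simps)
        also have "\<dots> \<le> norm (z - p) + norm v" using t by (simp add: mult_left_le_one_le)
        also have "\<dots> < d1" using z v d by linarith
        finally have "dist (J (z + t *\<^sub>R v)) (J p) < e'"
          using seg[of t] t closure_subset by (intro d1(2)) (auto simp: dist_norm subset_iff)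
        then have "norm (J (z + t *\<^sub>R v) - J p) * norm v * K \<le> e' * norm v * K"
          using K by (intro mult_right_mono) (auto simp: dist_norm)
        then show "norm (J (z + t *\<^sub>R v) *v v - J p *v v) \<le> e' * K * norm v"
          using K(2)[of "J (z + t *\<^sub>R v) - J p" v] by (simp add: matrix_vector_mult_diff_rdistrib mult_ac)
      qed
    qed
    have "norm (u y - u p - J p *v (y - p)) \<le> e * norm (y - p)"
      if y: "y \<in> closure \<Omega>" "norm (y - p) < d" for y
    proof (cases "y = p")
      case False
      define s where "s = norm (y - p)"
      have s: "s > 0" "s < d" using False y by (auto simp: s_def)
      define v w where "v = (- 2 * s) *\<^sub>R ?n" and "w = p + v - y"
      have nv: "norm v = 2 * s" using n s by (simp add: v_def)
      have "norm w \<le> norm v + norm (y - p)"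
        unfolding w_def using norm_triangle_ineq4[of v "y - p"] by (simp add: algebra_simps)
      then have nw: "norm w \<le> 3 * s" using nv by (simp add: s_def)
      have vn: "v \<bullet> ?n = - 2 * s" using n by (simp add: v_def norm_eq_1)
      have "(p - y) \<bullet> ?n \<le> norm (p - y) * norm ?n" by (rule norm_cauchy_schwarz)
      then have "w \<bullet> ?n \<le> - s"
        using vn n by (simp add: w_def s_def norm_minus_commute inner_diff_left inner_add_left)
      then have wn: "w \<bullet> ?n \<le> - (norm w / 3)" "w \<noteq> 0" using nw s by auto
      have 1: "norm (u (p + v) - u p - J p *v v) \<le> e' * K * (2 * s)"
      proof -
        have "norm v < 3 * d" "v \<noteq> 0" "v \<bullet> ?n \<le> - (norm v / 3)" using nv vn s by auto
        with increment[of p v] p' d nv show ?thesis by simp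
      qed
      have 2: "norm (u (p + v) - u y - J p *v w) \<le> e' * K * norm w"
      proof -
        have "norm w < 3 * d" using nw s by linarith
        moreover have "y + w = p + v" by (simp add: w_def)
        ultimately show ?thesis using increment[of y w] y wn by simp
      qed
      have "e' * K * norm w \<le> e' * K * (3 * s)" using nw e' K by simp
      with 2 have 2: "norm (u (p + v) - u y - J p *v w) \<le> e' * K * (3 * s)" by linarith
      have "y - p = v - w" by (simp add: w_def)
      then have "u y - u p - J p *v (y - p)
          = (u (p + v) - u p - J p *v v) - (u (p + v) - u y - J p *v w)"
        by (simp add: matrix_vector_mult_diff_distrib)
      also have "norm \<dots> \<le> e' * K * (2 * s) + e' * K * (3 * s)"
        using norm_triangle_ineq4 1 2 by (rule order_trans[OF _ add_mono])
      also have "\<dots> = e * s" using K by (simp add: e'_def)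
      finally show ?thesis by (simp add: s_def)
    qed simp
    then show ?thesis using d by blast
  qed
  then show ?thesis
    unfolding has_derivative_within_alt Jp by (simp add: matrix_vector_mul_bounded_linear)
qed

end


section \<open>Right-handed frames and the curl\<close>

text \<open>The Riesz representation of a functional on the plane orthogonal to \<open>n\<close>. It resolves the
  definite descriptions in the surface gradient and the shape operator.\<close>

lemma tangential_representative:
  fixes n :: "'a::euclidean_space" and L :: "'a \<Rightarrow> real"
  assumes n: "norm n = 1" and L: "linear L"
  shows "\<exists>!g. g \<bullet> n = 0 \<and> (\<forall>a. a \<bullet> n = 0 \<longrightarrow> g \<bullet> a = L a)"
proof (rule ex_ex1I)
  obtain v where v: "\<And>a. L a = a \<bullet> v" using linear_functional_eq_inner[OF L] by blast
  have "n \<bullet> n = 1" using n by (simp add: norm_eq_1)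
  then show "\<exists>g. g \<bullet> n = 0 \<and> (\<forall>a. a \<bullet> n = 0 \<longrightarrow> g \<bullet> a = L a)"
    by (intro exI[of _ "v - (v \<bullet> n) *\<^sub>R n"]) (simp add: v inner_diff_left inner_diff_right inner_commute)
next
  fix g h
  assume "g \<bullet> n = 0 \<and> (\<forall>a. a \<bullet> n = 0 \<longrightarrow> g \<bullet> a = L a)"
    and "h \<bullet> n = 0 \<and> (\<forall>a. a \<bullet> n = 0 \<longrightarrow> h \<bullet> a = L a)"
  then have "(g - h) \<bullet> n = 0" "\<And>a. a \<bullet> n = 0 \<Longrightarrow> (g - h) \<bullet> a = 0" by (simp_all add: inner_diff_left)
  then have "(g - h) \<bullet> (g - h) = 0" by blast
  then show "g = h" by simp
qed

text \<open>The frame-independent form of the curl: \<open>v \<mapsto> (\<nabla> \<times> u) \<times> v\<close> is \<open>J - J\<^sup>T\<close>.\<close>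

lemma curl_dot_cross3:
  "curl \<Omega> u x \<bullet> cross3 a b = (ext_jacobian \<Omega> u x *v a) \<bullet> b - (ext_jacobian \<Omega> u x *v b) \<bullet> a"
  by (simp add: curl_def Let_def cross_components vector_3 inner_vec_def sum_3
      matrix_vector_mult_def algebra_simps)

locale right_handed_frame =
  fixes e1 e2 n :: "real^3"
  assumes e11: "e1 \<bullet> e1 = 1" and e22: "e2 \<bullet> e2 = 1" and e12: "e1 \<bullet> e2 = 0"
    and cross12: "cross3 e1 e2 = n"
begin

lemma normal_orthogonal: "e1 \<bullet> n = 0" "e2 \<bullet> n = 0" "n \<bullet> e1 = 0" "n \<bullet> e2 = 0"
  using dot_cross_self[of e1 e2] dot_cross_self[of e2 e1] by (simp_all add: cross12[symmetric] dot_cross_self)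

lemma normal_unit: "n \<bullet> n = 1"
  using dot_cross[of e1 e2 e1 e2] by (simp add: cross12 e11 e22 e12 inner_commute[of e2 e1])

lemma cross_normal: "cross3 e2 n = e1" "cross3 n e1 = e2"
  using Lagrange[of e2 e1 e2] Lagrange[of e1 e1 e2] cross_skew[of n e1]
  by (simp_all add: cross12 e11 e22 e12 inner_commute[of e2 e1])

text \<open>A vector orthogonal to \<open>e1\<close> and \<open>e2\<close> is parallel to their cross product \<open>n\<close>, by Lagrange's
  formula for iterated cross products.\<close>

lemma eq_iff_components: "v = w \<longleftrightarrow> v \<bullet> e1 = w \<bullet> e1 \<and> v \<bullet> e2 = w \<bullet> e2 \<and> v \<bullet> n = w \<bullet> n"
proof
  assume eq: "v \<bullet> e1 = w \<bullet> e1 \<and> v \<bullet> e2 = w \<bullet> e2 \<and> v \<bullet> n = w \<bullet> n"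
  have "cross3 (v - w) n = 0"
    using eq Lagrange[of "v - w" e1 e2] by (simp add: cross12 inner_diff_left)
  moreover have "(v - w) \<bullet> n = 0" using eq by (simp add: inner_diff_left)
  ultimately have "v - w = 0" using norm_and_cross_eq_0[of "v - w" n] normal_unit by auto
  then show "v = w" by simp
qed simp

lemma tangential_expansion: "v - (v \<bullet> n) *\<^sub>R n = (v \<bullet> e1) *\<^sub>R e1 + (v \<bullet> e2) *\<^sub>R e2"
  unfolding eq_iff_components
  by (simp add: inner_add_left inner_diff_left e11 e22 e12 inner_commute[of e2 e1] normal_orthogonal normal_unit)

lemma cross_normal_components:
  "cross3 n v \<bullet> e1 = - (v \<bullet> e2)" "cross3 n v \<bullet> e2 = v \<bullet> e1" "cross3 n v \<bullet> n = 0"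
proof -
  have "cross3 n v \<bullet> e1 = v \<bullet> cross3 e1 n" "cross3 n v \<bullet> e2 = v \<bullet> cross3 e2 n"
    by (simp_all add: cross3_simps)
  then show "cross3 n v \<bullet> e1 = - (v \<bullet> e2)" "cross3 n v \<bullet> e2 = v \<bullet> e1"
    using cross_normal cross_skew[of e1 n] by simp_all
qed (rule dot_cross_self)

end

lemma compatible_frame_right_handed:
  assumes "compatible_frame \<Omega> W e" "x \<in> W" "x \<in> frontier \<Omega>"
  shows "right_handed_frame (e 1 x) (e 2 x) (outward_normal \<Omega> x)" "e 3 x = outward_normal \<Omega> x"
proof -
  have "x \<in> W \<inter> closure \<Omega>" using assms by (simp add: frontier_def)
  then show "right_handed_frame (e 1 x) (e 2 x) (outward_normal \<Omega> x)" "e 3 x = outward_normal \<Omega> x"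
    using assms unfolding compatible_frame_def right_handed_frame_def by auto
qed

context boundary_chart
begin

text \<open>Near \<open>p\<close> the normal stays transversal to a fixed coordinate vector \<open>c\<close>, and
  normalising \<open>n \<times> c\<close> yields a smooth tangent field that completes \<open>n\<close> to a frame.\<close>

lemma compatible_frame_exists:
  assumes p: "p \<in> U" "p \<in> frontier \<Omega>"
  obtains W e where "compatible_frame \<Omega> W e" "p \<in> W"
proof -
  have "chart_normal p \<noteq> 0" using norm_chart_normal[OF p(1)] by auto
  then obtain c where c: "cross3 (chart_normal p) c \<noteq> 0" using cross_basis_nonzero by blast
  define W where "W = {x \<in> U. cross3 (chart_normal x) c \<noteq> 0}"
  have smooth: "smooth_map_on (\<lambda>x. cross3 (chart_normal x) c) U"
    by (intro smooth_map_on_cross3 smooth_chart_normal smooth_map_on_const open_chart)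
  have "open (U \<inter> (\<lambda>x. cross3 (chart_normal x) c) -` (- {0}))"
    by (rule continuous_open_preimage[OF smooth_map_on_continuous[OF smooth] open_chart]) auto
  then have W: "open W" "W \<subseteq> U" "p \<in> W" using c p by (auto simp: W_def vimage_def Int_def)
  define e2 where "e2 x = cross3 (chart_normal x) c /\<^sub>R norm (cross3 (chart_normal x) c)" for x
  define e1 where "e1 x = cross3 (e2 x) (chart_normal x)" for x
  define e :: "3 \<Rightarrow> real^3 \<Rightarrow> real^3" where
    "e i = (if i = 1 then e1 else if i = 2 then e2 else chart_normal)" for i
  have N: "smooth_map_on chart_normal W" by (rule smooth_map_on_subset[OF smooth_chart_normal W(2,1)])
  have e2: "smooth_map_on e2 W" unfolding e2_def
    by (rule smooth_map_on_unit[OF smooth_map_on_subset[OF smooth W(2,1)]]) (simp add: W_def)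
  have e1: "smooth_map_on e1 W" unfolding e1_def by (intro smooth_map_on_cross3 e2 N)
  have "compatible_frame \<Omega> W e"
    unfolding compatible_frame_def
  proof (intro conjI ballI allI)
    show "smooth_map_on (e i) W" for i using N e1 e2 by (simp add: e_def)
    show "e 3 x = outward_normal \<Omega> x" if "x \<in> W \<inter> frontier \<Omega>" for x
      using that W(2) outward_normal_eq_chart_normal by (auto simp: e_def)
    fix x assume x: "x \<in> W \<inter> closure \<Omega>"
    have NN: "chart_normal x \<bullet> chart_normal x = 1"
      using x W(2) norm_chart_normal by (auto simp flip: norm_eq_1)
    have "norm (e2 x) = 1" using x by (simp add: e2_def W_def)
    then have 22: "e2 x \<bullet> e2 x = 1" by (simp add: norm_eq_1)
    have 2: "e2 x \<bullet> chart_normal x = 0" "chart_normal x \<bullet> e2 x = 0" by (simp_all add: e2_def dot_cross_self)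
    have 1: "e1 x \<bullet> chart_normal x = 0" "chart_normal x \<bullet> e1 x = 0" "e1 x \<bullet> e2 x = 0" "e2 x \<bullet> e1 x = 0"
      by (simp_all add: e1_def dot_cross_self)
    have 11: "e1 x \<bullet> e1 x = 1" by (simp add: e1_def dot_cross 22 NN 2)
    have "cross3 (e1 x) (e2 x) = chart_normal x"
      using Lagrange[of "e2 x" "e2 x" "chart_normal x"] cross_skew[of "e1 x" "e2 x"]
      by (simp add: e1_def 22 2)
    then show "cross3 (e 1 x) (e 2 x) = e 3 x" by (simp add: e_def)
    show "e i x \<bullet> e j x = (if i = j then 1 else 0)" for i j
      using exhaust_3[of i] exhaust_3[of j] by (auto simp: e_def NN 22 11 1 2)
  qed
  then show ?thesis using that W(3) by blast
qed


section \<open>The boundary geometry at a point\<close>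

lemma norm_outward_normal: "x \<in> U \<Longrightarrow> x \<in> frontier \<Omega> \<Longrightarrow> norm (outward_normal \<Omega> x) = 1"
  using norm_chart_normal outward_normal_eq_chart_normal by simp

lemma second_fundamental_form_symmetric:
  assumes "x \<in> U" "x \<in> frontier \<Omega>" "a \<in> tangent_plane \<Omega> x" "b \<in> tangent_plane \<Omega> x"
  shows "second_fundamental_form \<Omega> x a b = second_fundamental_form \<Omega> x b a"
  using assms chart_normal_derivative_symmetric[OF assms(1), of a b]
  by (simp add: second_fundamental_form_def surface_deriv_outward_normal
      tangent_plane_def outward_normal_eq_chart_normal)

lemma second_fundamental_form_linear:
  assumes "x \<in> U" "x \<in> frontier \<Omega>" "a \<in> tangent_plane \<Omega> x" "b \<in> tangent_plane \<Omega> x"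
  shows "second_fundamental_form \<Omega> x (s *\<^sub>R a + t *\<^sub>R b) c
    = s * second_fundamental_form \<Omega> x a c + t * second_fundamental_form \<Omega> x b c"
proof -
  have "linear (frechet_derivative chart_normal (at x))"
    using has_derivative_linear[OF smooth_map_on_has_derivative[OF smooth_chart_normal assms(1)]] .
  moreover have "s *\<^sub>R a + t *\<^sub>R b \<in> tangent_plane \<Omega> x"
    using assms by (simp add: tangent_plane_def inner_add_left)
  ultimately show ?thesis
    using assms by (simp add: second_fundamental_form_def surface_deriv_outward_normal linear_add linear_scale inner_add_left)
qed

text \<open>Product rule for \<open>\<langle>u, \<nu>\<rangle>\<close>. The normal part of \<open>u\<close> drops out of the second term because
  \<open>\<nu>\<close> has constant length.\<close>

lemma surface_deriv_normal_component:
  assumes x: "x \<in> U" "x \<in> frontier \<Omega>" and a: "a \<in> tangent_plane \<Omega> x"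
    and C1: "C1_on_closure \<Omega> u"
  shows "surface_deriv \<Omega> (normal_component \<Omega> u) x a
    = (ext_jacobian \<Omega> u x *v a) \<bullet> outward_normal \<Omega> x
      + second_fundamental_form \<Omega> x a (tangential_part \<Omega> x (u x))"
proof -
  let ?D = "frechet_derivative chart_normal (at x)"
  have "frontier \<Omega> \<subseteq> closure \<Omega>" by (auto simp: frontier_def)
  with C1_on_closure_has_derivative[OF C1 x]
  have u: "(u has_derivative (*v) (ext_jacobian \<Omega> u x)) (at x within frontier \<Omega>)"
    by (rule has_derivative_subset)
  have "(normal_component \<Omega> u has_derivative
      (\<lambda>h. u x \<bullet> ?D h + (ext_jacobian \<Omega> u x *v h) \<bullet> outward_normal \<Omega> x)) (at x within frontier \<Omega>)"
    using has_derivative_inner[OF u outward_normal_has_derivative[OF x]]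
    by (simp add: normal_component_def[abs_def])
  from surface_deriv_eq[OF x a this]
  have "surface_deriv \<Omega> (normal_component \<Omega> u) x a
      = u x \<bullet> ?D a + (ext_jacobian \<Omega> u x *v a) \<bullet> outward_normal \<Omega> x" .
  moreover have "?D a \<bullet> tangential_part \<Omega> x (u x) = u x \<bullet> ?D a"
    using chart_normal_derivative_tangential[OF x(1), of a] outward_normal_eq_chart_normal[OF x]
    by (simp add: tangential_part_def normal_part_def inner_diff_right inner_commute)
  ultimately show ?thesis
    by (simp add: second_fundamental_form_def surface_deriv_outward_normal[OF x a])
qed

text \<open>On the tangent plane the surface derivative of \<open>\<langle>u, \<nu>\<rangle>\<close> agrees with a linear map of the
  ambient space, so a representing tangent vector exists.\<close>

lemma surface_grad_normal_component:
  assumes x: "x \<in> U" "x \<in> frontier \<Omega>" and C1: "C1_on_closure \<Omega> u"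
  shows "surface_grad \<Omega> (normal_component \<Omega> u) x \<in> tangent_plane \<Omega> x"
    "a \<in> tangent_plane \<Omega> x \<Longrightarrow> surface_grad \<Omega> (normal_component \<Omega> u) x \<bullet> a
      = surface_deriv \<Omega> (normal_component \<Omega> u) x a"
proof -
  let ?L = "\<lambda>a. (ext_jacobian \<Omega> u x *v a) \<bullet> outward_normal \<Omega> x
      + frechet_derivative chart_normal (at x) a \<bullet> tangential_part \<Omega> x (u x)"
  have L: "?L a = surface_deriv \<Omega> (normal_component \<Omega> u) x a" if "a \<in> tangent_plane \<Omega> x" for a
    using surface_deriv_normal_component[OF x that C1] surface_deriv_outward_normal[OF x that]
    by (simp add: second_fundamental_form_def)
  have lin: "linear (frechet_derivative chart_normal (at x))"
    using has_derivative_linear[OF smooth_map_on_has_derivative[OF smooth_chart_normal x(1)]] .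
  have "linear ?L"
    by (rule linearI) (simp_all add: matrix_vector_right_distrib matrix_vector_mult_scaleR
        linear_add[OF lin] linear_scale[OF lin] inner_add_left algebra_simps)
  from tangential_representative[OF norm_outward_normal[OF x] this]
  have "\<exists>!g. g \<in> tangent_plane \<Omega> x \<and>
      (\<forall>a\<in>tangent_plane \<Omega> x. g \<bullet> a = surface_deriv \<Omega> (normal_component \<Omega> u) x a)"
    using L by (simp add: tangent_plane_def)
  from theI'[OF this]
  show "surface_grad \<Omega> (normal_component \<Omega> u) x \<in> tangent_plane \<Omega> x"
    "a \<in> tangent_plane \<Omega> x \<Longrightarrow> surface_grad \<Omega> (normal_component \<Omega> u) x \<bullet> a
      = surface_deriv \<Omega> (normal_component \<Omega> u) x a"
    unfolding surface_grad_def by blast+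
qed

lemma shape_operator_dot:
  assumes x: "x \<in> U" "x \<in> frontier \<Omega>" and b: "b \<in> tangent_plane \<Omega> x"
  shows "shape_operator \<Omega> x a \<bullet> b = second_fundamental_form \<Omega> x a b"
proof -
  have "linear (\<lambda>b. second_fundamental_form \<Omega> x a b)"
    by (rule linearI) (simp_all add: second_fundamental_form_def inner_add_right)
  from tangential_representative[OF norm_outward_normal[OF x] this]
  have "\<exists>!w. w \<in> tangent_plane \<Omega> x \<and>
      (\<forall>b\<in>tangent_plane \<Omega> x. w \<bullet> b = second_fundamental_form \<Omega> x a b)"
    by (simp add: tangent_plane_def)
  from theI'[OF this] b show ?thesis unfolding shape_operator_def by blast
qed

end


section \<open>The Navier condition as a condition on the vorticity\<close>

definition vorticity_condition ::
    "(real^3) set \<Rightarrow> (real^3 \<Rightarrow> real) \<Rightarrow> (real^3 \<Rightarrow> real^3) \<Rightarrow> real^3 \<Rightarrow> bool" where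
  "vorticity_condition \<Omega> \<zeta> u x \<longleftrightarrow>
     tangential_part \<Omega> x (curl \<Omega> u x)
     = - (1 / \<zeta> x) *\<^sub>R hodge_star \<Omega> x (tangential_part \<Omega> x (u x))
       - 2 *\<^sub>R hodge_star \<Omega> x (surface_grad \<Omega> (normal_component \<Omega> u) x)
       + 2 *\<^sub>R hodge_star \<Omega> x (shape_operator \<Omega> x (tangential_part \<Omega> x (u x)))"

context boundary_chart
begin

context
  fixes u :: "real^3 \<Rightarrow> real^3" and x W :: _ and e :: "3 \<Rightarrow> real^3 \<Rightarrow> real^3" and \<zeta> :: "real^3 \<Rightarrow> real"
  assumes x: "x \<in> U" "x \<in> frontier \<Omega>" and C1: "C1_on_closure \<Omega> u"
    and frame: "compatible_frame \<Omega> W e" and xW: "x \<in> W"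
begin

interpretation F: right_handed_frame "e 1 x" "e 2 x" "outward_normal \<Omega> x"
  using compatible_frame_right_handed[OF frame xW x(2)] by blast

lemma frame_tangent: "e 1 x \<in> tangent_plane \<Omega> x" "e 2 x \<in> tangent_plane \<Omega> x"
  using F.normal_orthogonal by (simp_all add: tangent_plane_def)

lemma tangential_part_expansion:
  "tangential_part \<Omega> x v = frame_comp e x v 1 *\<^sub>R e 1 x + frame_comp e x v 2 *\<^sub>R e 2 x"
  using F.tangential_expansion[of v] by (simp add: tangential_part_def normal_part_def frame_comp_def)

lemma second_fundamental_form_tangential_part:
  assumes "b \<in> tangent_plane \<Omega> x"
  shows "second_fundamental_form \<Omega> x (tangential_part \<Omega> x v) b
    = (\<Sum>j\<in>{1, 2}. second_fundamental_form \<Omega> x (e j x) b * frame_comp e x v j)"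
  unfolding tangential_part_expansion second_fundamental_form_linear[OF x frame_tangent] by simp

lemma vorticity_condition_iff_components:
  "vorticity_condition \<Omega> \<zeta> u x \<longleftrightarrow>
     frame_comp e x (curl \<Omega> u x) 1
       = 1 / \<zeta> x * frame_comp e x (u x) 2
         + 2 * surface_deriv \<Omega> (normal_component \<Omega> u) x (e 2 x)
         - 2 * (\<Sum>j\<in>{1, 2}. second_fundamental_form \<Omega> x (e j x) (e 2 x) * frame_comp e x (u x) j) \<and>
     frame_comp e x (curl \<Omega> u x) 2
       = - (1 / \<zeta> x) * frame_comp e x (u x) 1
         - 2 * surface_deriv \<Omega> (normal_component \<Omega> u) x (e 1 x)
         + 2 * (\<Sum>j\<in>{1, 2}. second_fundamental_form \<Omega> x (e j x) (e 1 x) * frame_comp e x (u x) j)"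
proof -
  have T: "tangential_part \<Omega> x v \<bullet> e 1 x = frame_comp e x v 1"
    "tangential_part \<Omega> x v \<bullet> e 2 x = frame_comp e x v 2"
    "tangential_part \<Omega> x v \<bullet> outward_normal \<Omega> x = 0" for v
    using F.normal_orthogonal F.normal_unit
    by (simp_all add: tangential_part_def normal_part_def frame_comp_def inner_diff_left)
  show ?thesis
    unfolding vorticity_condition_def F.eq_iff_components
      second_fundamental_form_tangential_part[OF frame_tangent(1), symmetric]
      second_fundamental_form_tangential_part[OF frame_tangent(2), symmetric]
      hodge_star_def inner_add_left inner_diff_left inner_scaleR_left F.cross_normal_components T
      surface_grad_normal_component(2)[OF x C1 frame_tangent(1)]
      surface_grad_normal_component(2)[OF x C1 frame_tangent(2)]
      shape_operator_dot[OF x frame_tangent(1)] shape_operator_dot[OF x frame_tangent(2)]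
    by simp
qed

text \<open>Write \<open>J\<close> for the Jacobian. In a frame, \<open>(\<nabla> \<times> u)\<^sup>1 = \<langle>J e\<^sub>2, \<nu>\<rangle> - \<langle>J \<nu>, e\<^sub>2\<rangle>\<close>, which is twice
  \<open>\<langle>J e\<^sub>2, \<nu>\<rangle>\<close> minus the shear \<open>\<langle>J e\<^sub>2, \<nu>\<rangle> + \<langle>J \<nu>, e\<^sub>2\<rangle>\<close> that the Navier condition prescribes;
  \<open>\<langle>J e\<^sub>2, \<nu>\<rangle>\<close> is in turn given by the product rule for \<open>\<langle>u, \<nu>\<rangle>\<close>. The symmetry of the second
  fundamental form moves \<open>e\<^sub>2\<close> to its second argument.\<close>

lemma navier_at_point_iff_vorticity_condition:
  assumes \<zeta>: "\<zeta> x > 0"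
  shows "(\<forall>k\<in>{1, 2}. frame_comp e x (u x) k
            = - \<zeta> x * (frame_nabla \<Omega> e u x 3 k + frame_nabla \<Omega> e u x k 3)) \<longleftrightarrow>
         vorticity_condition \<Omega> \<zeta> u x"
proof -
  let ?J = "ext_jacobian \<Omega> u x" and ?n = "outward_normal \<Omega> x"
  have e3: "e 3 x = ?n" using compatible_frame_right_handed[OF frame xW x(2)] by blast
  have curl: "frame_comp e x (curl \<Omega> u x) 1 = (?J *v e 2 x) \<bullet> ?n - (?J *v ?n) \<bullet> e 2 x"
    "frame_comp e x (curl \<Omega> u x) 2 = (?J *v ?n) \<bullet> e 1 x - (?J *v e 1 x) \<bullet> ?n"
    using curl_dot_cross3[of \<Omega> u x "e 2 x" ?n] curl_dot_cross3[of \<Omega> u x ?n "e 1 x"]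
    by (simp_all add: frame_comp_def F.cross_normal)
  have tan: "tangential_part \<Omega> x (u x) \<in> tangent_plane \<Omega> x"
    using F.normal_unit by (simp add: tangential_part_def normal_part_def tangent_plane_def inner_diff_left)
  have S: "surface_deriv \<Omega> (normal_component \<Omega> u) x (e k x) = (?J *v e k x) \<bullet> ?n
      + (\<Sum>j\<in>{1, 2}. second_fundamental_form \<Omega> x (e j x) (e k x) * frame_comp e x (u x) j)"
    if "e k x \<in> tangent_plane \<Omega> x" for k
    unfolding surface_deriv_normal_component[OF x that C1]
      second_fundamental_form_symmetric[OF x that tan] second_fundamental_form_tangential_part[OF that] ..
  have "(\<forall>k\<in>{1, 2}. frame_comp e x (u x) k
            = - \<zeta> x * (frame_nabla \<Omega> e u x 3 k + frame_nabla \<Omega> e u x k 3)) \<longleftrightarrow>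
      1 / \<zeta> x * frame_comp e x (u x) 1 = - ((?J *v ?n) \<bullet> e 1 x + (?J *v e 1 x) \<bullet> ?n) \<and>
      1 / \<zeta> x * frame_comp e x (u x) 2 = - ((?J *v ?n) \<bullet> e 2 x + (?J *v e 2 x) \<bullet> ?n)"
    using \<zeta> by (auto simp: frame_nabla_def frame_comp_def e3 field_simps)
  then show ?thesis
    unfolding vorticity_condition_iff_components curl S[OF frame_tangent(1)] S[OF frame_tangent(2)] by argo
qed

end

text \<open>If \<open>\<langle>u, \<nu>\<rangle>\<close> vanishes on the boundary, so does its surface gradient, and \<open>u\<close> is its own
  tangential part.\<close>

lemma vorticity_condition_kinematic:
  assumes x: "x \<in> U" "x \<in> frontier \<Omega>" and C1: "C1_on_closure \<Omega> u"
    and kin: "\<And>y. y \<in> frontier \<Omega> \<Longrightarrow> normal_part \<Omega> y (u y) = 0"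
    and normal_nz: "\<And>y. y \<in> frontier \<Omega> \<Longrightarrow> outward_normal \<Omega> y \<noteq> 0"
  shows "vorticity_condition \<Omega> \<zeta> u x \<longleftrightarrow>
     tangential_part \<Omega> x (curl \<Omega> u x)
     = - (1 / \<zeta> x) *\<^sub>R hodge_star \<Omega> x (u x) + 2 *\<^sub>R hodge_star \<Omega> x (shape_operator \<Omega> x (u x))"
proof -
  have zero: "normal_component \<Omega> u y = 0" if "y \<in> frontier \<Omega>" for y
    using kin[OF that] normal_nz[OF that] by (simp add: normal_part_def normal_component_def)
  have "((\<lambda>y. 0 :: real) has_derivative (\<lambda>h. 0)) (at x within frontier \<Omega>)" by simp
  then have "(normal_component \<Omega> u has_derivative (\<lambda>h. 0)) (at x within frontier \<Omega>)"
    by (rule has_derivative_transform_within[OF _ zero_less_one x(2)]) (simp add: zero)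
  then have "surface_deriv \<Omega> (normal_component \<Omega> u) x a = 0" if "a \<in> tangent_plane \<Omega> x" for a
    using surface_deriv_eq[OF x that] by blast
  then have "surface_grad \<Omega> (normal_component \<Omega> u) x \<bullet> surface_grad \<Omega> (normal_component \<Omega> u) x = 0"
    using surface_grad_normal_component[OF x C1] by simp
  then have "surface_grad \<Omega> (normal_component \<Omega> u) x = 0" by simp
  moreover have "tangential_part \<Omega> x (u x) = u x" using kin[OF x(2)] by (simp add: tangential_part_def)
  ultimately show ?thesis by (simp add: vorticity_condition_def hodge_star_def)
qed

end

lemma bounded_smooth_domain_chart:
  assumes "bounded_smooth_domain \<Omega>" "p \<in> frontier \<Omega>"
  obtains U \<phi> where "boundary_chart \<Omega> U \<phi>" "p \<in> U"
  using assms unfolding bounded_smooth_domain_def boundary_chart_def by blast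

theorem proposition2p1:
  fixes \<Omega> :: "(real^3) set"
    and \<zeta> :: "real^3 \<Rightarrow> real"
    and u :: "real^3 \<Rightarrow> real^3"
  assumes "bounded_smooth_domain \<Omega>"
    and "\<And>x. x \<in> frontier \<Omega> \<Longrightarrow> \<zeta> x > 0"
    and "C1_on_closure \<Omega> u"
  shows "(navier_bc \<Omega> \<zeta> u \<longleftrightarrow>
           (\<forall>x\<in>frontier \<Omega>.
              tangential_part \<Omega> x (curl \<Omega> u x)
              = - (1 / \<zeta> x) *\<^sub>R hodge_star \<Omega> x (tangential_part \<Omega> x (u x))
                - 2 *\<^sub>R hodge_star \<Omega> x (surface_grad \<Omega> (normal_component \<Omega> u) x)
                + 2 *\<^sub>R hodge_star \<Omega> x (shape_operator \<Omega> x (tangential_part \<Omega> x (u x)))))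
       \<and> (\<forall>W e. compatible_frame \<Omega> W e \<longrightarrow>
           (\<forall>x \<in> W \<inter> frontier \<Omega>.
              tangential_part \<Omega> x (curl \<Omega> u x)
              = - (1 / \<zeta> x) *\<^sub>R hodge_star \<Omega> x (tangential_part \<Omega> x (u x))
                - 2 *\<^sub>R hodge_star \<Omega> x (surface_grad \<Omega> (normal_component \<Omega> u) x)
                + 2 *\<^sub>R hodge_star \<Omega> x (shape_operator \<Omega> x (tangential_part \<Omega> x (u x)))
              \<longleftrightarrow>
              frame_comp e x (curl \<Omega> u x) 1
              = 1 / \<zeta> x * frame_comp e x (u x) 2
                + 2 * surface_deriv \<Omega> (normal_component \<Omega> u) x (e 2 x)
                - 2 * (\<Sum>j\<in>{1, 2}. second_fundamental_form \<Omega> x (e j x) (e 2 x)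
                                    * frame_comp e x (u x) j)
              \<and>
              frame_comp e x (curl \<Omega> u x) 2
              = - (1 / \<zeta> x) * frame_comp e x (u x) 1
                - 2 * surface_deriv \<Omega> (normal_component \<Omega> u) x (e 1 x)
                + 2 * (\<Sum>j\<in>{1, 2}. second_fundamental_form \<Omega> x (e j x) (e 1 x)
                                    * frame_comp e x (u x) j)))
       \<and> ((\<forall>x\<in>frontier \<Omega>. normal_part \<Omega> x (u x) = 0) \<longrightarrow>
           (navier_bc \<Omega> \<zeta> u \<longleftrightarrow>
             (\<forall>x\<in>frontier \<Omega>.
                tangential_part \<Omega> x (curl \<Omega> u x)
                = - (1 / \<zeta> x) *\<^sub>R hodge_star \<Omega> x (u x)
                  + 2 *\<^sub>R hodge_star \<Omega> x (shape_operator \<Omega> x (u x)))))"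
  unfolding vorticity_condition_def[symmetric]
proof (intro conjI allI impI ballI)
  note \<zeta> = assms(2) and C1 = assms(3)
  have chart: "\<exists>U \<phi>. boundary_chart \<Omega> U \<phi> \<and> x \<in> U" if "x \<in> frontier \<Omega>" for x
    using bounded_smooth_domain_chart[OF assms(1) that] by blast
  have at_point: "(\<forall>k\<in>{1, 2}. frame_comp e x (u x) k
            = - \<zeta> x * (frame_nabla \<Omega> e u x 3 k + frame_nabla \<Omega> e u x k 3)) \<longleftrightarrow>
         vorticity_condition \<Omega> \<zeta> u x"
    if "compatible_frame \<Omega> W e" "x \<in> W" "x \<in> frontier \<Omega>" for W e x
  proof -
    obtain U \<phi> where "boundary_chart \<Omega> U \<phi>" "x \<in> U" using chart \<open>x \<in> frontier \<Omega>\<close> by blast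
    from boundary_chart.navier_at_point_iff_vorticity_condition[OF this that(3) C1 that(1,2), where \<zeta> = \<zeta>]
    show ?thesis using \<zeta>[OF that(3)] .
  qed
  have frame: "\<exists>W e. compatible_frame \<Omega> W e \<and> x \<in> W" if "x \<in> frontier \<Omega>" for x
  proof -
    obtain U \<phi> where "boundary_chart \<Omega> U \<phi>" "x \<in> U" using chart \<open>x \<in> frontier \<Omega>\<close> by blast
    from boundary_chart.compatible_frame_exists[OF this that] show ?thesis by blast
  qed
  show navier: "navier_bc \<Omega> \<zeta> u \<longleftrightarrow> (\<forall>x\<in>frontier \<Omega>. vorticity_condition \<Omega> \<zeta> u x)"
  proof
    assume nb: "navier_bc \<Omega> \<zeta> u"
    show "\<forall>x\<in>frontier \<Omega>. vorticity_condition \<Omega> \<zeta> u x"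
    proof
      fix x assume x: "x \<in> frontier \<Omega>"
      then obtain W e where W: "compatible_frame \<Omega> W e" "x \<in> W" using frame by blast
      then show "vorticity_condition \<Omega> \<zeta> u x"
        using nb x at_point[OF W x] unfolding navier_bc_def by blast
    qed
  next
    assume "\<forall>x\<in>frontier \<Omega>. vorticity_condition \<Omega> \<zeta> u x"
    then show "navier_bc \<Omega> \<zeta> u"
      unfolding navier_bc_def using at_point by blast
  qed
  show "vorticity_condition \<Omega> \<zeta> u x \<longleftrightarrow>
     frame_comp e x (curl \<Omega> u x) 1
       = 1 / \<zeta> x * frame_comp e x (u x) 2
         + 2 * surface_deriv \<Omega> (normal_component \<Omega> u) x (e 2 x)
         - 2 * (\<Sum>j\<in>{1, 2}. second_fundamental_form \<Omega> x (e j x) (e 2 x) * frame_comp e x (u x) j) \<and>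
     frame_comp e x (curl \<Omega> u x) 2
       = - (1 / \<zeta> x) * frame_comp e x (u x) 1
         - 2 * surface_deriv \<Omega> (normal_component \<Omega> u) x (e 1 x)
         + 2 * (\<Sum>j\<in>{1, 2}. second_fundamental_form \<Omega> x (e j x) (e 1 x) * frame_comp e x (u x) j)"
    if W: "compatible_frame \<Omega> W e" and x: "x \<in> W \<inter> frontier \<Omega>" for W e x
  proof -
    obtain U \<phi> where "boundary_chart \<Omega> U \<phi>" "x \<in> U" using chart x by blast
    from boundary_chart.vorticity_condition_iff_components[OF this _ C1 W, where \<zeta> = \<zeta>] x
    show ?thesis by blast
  qed
  assume kin: "\<forall>x\<in>frontier \<Omega>. normal_part \<Omega> x (u x) = 0"
  have normal_nz: "outward_normal \<Omega> y \<noteq> 0" if y: "y \<in> frontier \<Omega>" for y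
  proof -
    obtain U \<phi> where "boundary_chart \<Omega> U \<phi>" "y \<in> U" using chart y by blast
    from boundary_chart.norm_outward_normal[OF this y] show ?thesis by auto
  qed
  have "vorticity_condition \<Omega> \<zeta> u x \<longleftrightarrow> tangential_part \<Omega> x (curl \<Omega> u x)
      = - (1 / \<zeta> x) *\<^sub>R hodge_star \<Omega> x (u x) + 2 *\<^sub>R hodge_star \<Omega> x (shape_operator \<Omega> x (u x))"
    if x: "x \<in> frontier \<Omega>" for x
  proof -
    obtain U \<phi> where "boundary_chart \<Omega> U \<phi>" "x \<in> U" using chart x by blast
    from boundary_chart.vorticity_condition_kinematic[OF this x C1 kin[rule_format] normal_nz, where \<zeta> = \<zeta>]
    show ?thesis by blast
  qed
  with navier show "navier_bc \<Omega> \<zeta> u \<longleftrightarrow>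
     (\<forall>x\<in>frontier \<Omega>. tangential_part \<Omega> x (curl \<Omega> u x)
        = - (1 / \<zeta> x) *\<^sub>R hodge_star \<Omega> x (u x) + 2 *\<^sub>R hodge_star \<Omega> x (shape_operator \<Omega> x (u x)))"
    by simp
qed

end
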